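(* Let $S_k$ be a finite index set with $p_k=|S_k|$, let $x_k=\{X_i\}_{i\in S_k}$ be the real $n\times p_k$ matrix with standardized columns $X_i$, let $\delta>0$, and let $D$ be a positive-definite $p_k\times p_k$ matrix indexed by $S_k$. Let $\widetilde{\mathrm{Pr}}[\,\cdot\mid x_k]$ be the conditional distribution on trees $T_k=(S_k,E_k)$ given $x_k$, and let the weights $w_{ij}$ and the resistance distance $r(i,j)$ be as defined in the context. Then, for distinct nodes $i,j\in S_k$: (i) $\widetilde{\mathrm{Pr}}[(i,j)\in E_k\mid x_k]=w_{ij}\,r(i,j)$; (ii) $\widetilde{\mathrm{Pr}}[(i,j)\in E_k\mid x_k]$ is an increasing function of $w_{ij}$.
   Context: The columns $X_i\in\mathbb{R}^n$ are standardized: the entries of $X_i$ sum to $0$ and $\|X_i\|^2=n$ (Euclidean norm). $|\cdot|$ applied to a matrix denotes the determinant (the determinant of a $0\times0$ matrix is $1$). Trees: a tree $T_k=(S_k,E_k)$ is a connected acyclic undirected graph with vertex set $S_k$ (all vertices included); edges are unordered pairs. All trees are labelled, so there are $p_k^{p_k-2}$ of them. Model: writing $x_{ik}$ for the $i$-th row of $x_k$, \[ \widetilde p(x_k\mid\Delta_k)=\prod_{i=1}^n \mathcal N(x_{ik}\mid 0_{p_k\times1},\Delta_k^{-1}),\qquad \widetilde p(x_k\mid T_k)=\int \widetilde p(x_k\mid\Delta_k)\,\widetilde p(\Delta_k\mid T_k)\,d\Delta_k , \] where $\mathcal N(\cdot\mid 0,\Delta_k^{-1})$ is the multivariate Gaussian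 density with precision matrix $\Delta_k$, and $\widetilde p(\Delta_k\mid T_k)$ is the Hyper-Wishart ($G$-Wishart) distribution with respect to $T_k$ with degrees of freedom $\delta$ and rate matrix $D$: the probability density proportional to $|\Delta_k|^{\delta/2-1}\exp\{-\tfrac12\mathrm{tr}(\Delta_k D)\}$ on the set of symmetric positive-definite matrices $\Delta_k$ indexed by $S_k$ whose off-diagonal entries $(i,j)$ vanish unless $(i,j)$ is an edge of $T_k$, with respect to Lebesgue measure on the free entries (the diagonal entries and the entries $(i,j)\in E_k$). The distribution on trees is uniform, $\widetilde p(T_k)=p_k^{2-p_k}$. The conditional distribution on trees given $x_k$ is $\widetilde{\mathrm{Pr}}[T_k\mid x_k]=\widetilde p(T_k)\,\widetilde p(x_k\mid T_k)\big/\sum_{T}\widetilde p(T)\,\widetilde p(x_k\mid T)$, the sum being over all trees $T$ on $S_k$. Weights: for $i\neq j$ in $S_k$ let $D_{\{i,j\}}$ be the $2\times2$ submatrix of $D$ with rows and columns indexed by $\{i,j\}$, and \[ g_{ij}(\delta,D)=\frac{\Gamma\{(\delta+1)/2\}\,(D_{ii}D_{jj})^{\delta/2}}{\Gamma(\delta/2)\,|D_{\{i,j\}}|^{(\delta+1)/2}},\qquad w_{ij}=\frac{g_{ij}(\delta^\star,D^\star)}{g_{ij}(\delta,D)},\qquad \delta^\star=\delta+n,\quad D^\star=D+x_k^\top x_k . \] Laplacian and resistance distance: for the weighted graph on $S_k$ with edge weights $w_{ij}$, the Laplacian $\Lambda$ is the $p_k\times p_k$ matrix with $\Lambda_{ij}=-w_{ij}$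 for $i\ne j$ and $\Lambda_{ii}=\sum_{j\neq i}w_{ij}$. For $\nu\subset S_k$, $\Lambda^{\nu}$ is the matrix obtained from $\Lambda$ by removing the rows and columns indexed by $\nu$. The resistance distance between $i$ and $j$ is $r(i,j)=|\Lambda^{\{i,j\}}|/|\Lambda^{\{i\}}|$. *)

theory Defs
  imports "HOL-Analysis.Analysis"
begin

text \<open>
  The index set of the variables is the finite type \<open>'k\<close> and the index set of the observations is the
  finite type \<open>'n\<close>; a data matrix \<open>x :: real^'k^'n\<close> has entry \<open>x $ a $ i\<close> for observation
  \<open>a\<close> of variable \<open>i\<close>.
\<close>

definition standardized :: "real^'k^'n \<Rightarrow> bool" where
  "standardized x \<longleftrightarrow>
     (\<forall>i. (\<Sum>a\<in>UNIV. column i x $ a) = 0 \<and> (norm (column i x))\<^sup>2 = real CARD('n))"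

definition pos_def :: "real^'k^'k \<Rightarrow> bool" where
  "pos_def A \<longleftrightarrow> transpose A = A \<and> (\<forall>v. v \<noteq> 0 \<longrightarrow> 0 < v \<bullet> (A *v v))"

text \<open>
  Determinant of the submatrix of \<open>A\<close> with rows and columns indexed by \<open>I\<close>: the Leibniz formula
  defining \<^const>\<open>det\<close>, with \<open>I\<close> in place of \<^const>\<open>UNIV\<close>.
\<close>

definition principal_minor :: "real^'k^'k \<Rightarrow> 'k set \<Rightarrow> real" where
  "principal_minor A I = (\<Sum>p | p permutes I. of_int (sign p) * (\<Prod>i\<in>I. A $ i $ p i))"

lemma principal_minor_UNIV: "principal_minor A UNIV = det A"
  by (simp add: principal_minor_def det_def)

lemma principal_minor_empty: "principal_minor A {} = 1"
  by (simp add: principal_minor_def)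

lemma principal_minor_pair:
  assumes "i \<noteq> j"
  shows "principal_minor A {i, j} = A $ i $ i * A $ j $ j - A $ i $ j * A $ j $ i"
proof -
  have "finite {j}" and "i \<notin> {j}"
    using assms by auto
  note ins = sum_over_permutations_insert[OF this]
  show ?thesis
    unfolding principal_minor_def ins permutes_sing
    using assms by (simp add: sign_swap_id sign_id)
qed

text \<open>An undirected edge is an unordered pair of distinct vertices, a graph is its edge set.\<close>

definition connected_graph :: "'k set set \<Rightarrow> bool" where
  "connected_graph E \<longleftrightarrow> (\<forall>u v. (u, v) \<in> {(a, b). {a, b} \<in> E}\<^sup>*)"

definition is_cycle :: "'k set set \<Rightarrow> 'k list \<Rightarrow> bool" where
  "is_cycle E c \<longleftrightarrow> 3 \<le> length c \<and> distinct c \<and>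
     (\<forall>m<length c. {c ! m, c ! (Suc m mod length c)} \<in> E)"

definition trees :: "'k::finite set set set" where
  "trees = {E. (\<forall>e\<in>E. card e = 2) \<and> connected_graph E \<and> (\<nexists>c. is_cycle E c)}"

text \<open>Density at \<open>y\<close> of the centred Gaussian distribution with precision matrix \<open>\<Delta>\<close>.\<close>

definition gaussian_density :: "real^'k^'k \<Rightarrow> real^'k \<Rightarrow> real" where
  "gaussian_density \<Delta> y =
     sqrt (det \<Delta> / (2 * pi) ^ CARD('k)) * exp (- (y \<bullet> (\<Delta> *v y)) / 2)"

definition likelihood :: "real^'k^'k \<Rightarrow> real^'k^'n \<Rightarrow> real" where
  "likelihood \<Delta> x = (\<Prod>a\<in>UNIV. gaussian_density \<Delta> (row a x))"

text \<open>
  The free entries of a symmetric matrix with sparsity pattern \<open>E\<close> are indexed by unordered pairs: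
  \<open>{i, j} \<in> E\<close> for an off-diagonal entry, and \<open>{i, i} = {i}\<close> for a diagonal entry.
\<close>

definition free_entries :: "'k set set \<Rightarrow> 'k set set" where
  "free_entries E = range (\<lambda>i. {i}) \<union> E"

definition matrix_of_entries :: "'k set set \<Rightarrow> ('k set \<Rightarrow> real) \<Rightarrow> real^'k^'k" where
  "matrix_of_entries E \<theta> = (\<chi> i j. if {i, j} \<in> free_entries E then \<theta> {i, j} else 0)"

definition entries_lebesgue :: "'k set set \<Rightarrow> ('k set \<Rightarrow> real) measure" where
  "entries_lebesgue E = (\<Pi>\<^sub>M e\<in>free_entries E. lborel)"

definition hyper_wishart_kernel :: "real \<Rightarrow> real^'k^'k \<Rightarrow> real^'k^'k \<Rightarrow> real" where
  "hyper_wishart_kernel \<delta> D \<Delta> =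
     (if pos_def \<Delta> then det \<Delta> powr (\<delta> / 2 - 1) * exp (- trace (\<Delta> ** D) / 2) else 0)"

definition hyper_wishart_density ::
    "real \<Rightarrow> real^'k^'k \<Rightarrow> 'k set set \<Rightarrow> ('k set \<Rightarrow> real) \<Rightarrow> real" where
  "hyper_wishart_density \<delta> D E \<theta> =
     hyper_wishart_kernel \<delta> D (matrix_of_entries E \<theta>) /
     (LINT \<eta>|entries_lebesgue E. hyper_wishart_kernel \<delta> D (matrix_of_entries E \<eta>))"

definition marginal_likelihood ::
    "real \<Rightarrow> real^'k^'k \<Rightarrow> real^'k^'n \<Rightarrow> 'k set set \<Rightarrow> real" where
  "marginal_likelihood \<delta> D x E =
     (LINT \<theta>|entries_lebesgue E.
        likelihood (matrix_of_entries E \<theta>) x * hyper_wishart_density \<delta> D E \<theta>)"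

definition tree_prior :: "'k::finite set set \<Rightarrow> real" where
  "tree_prior E = real CARD('k) powi (2 - int CARD('k))"

definition tree_posterior ::
    "real \<Rightarrow> real^'k^'k \<Rightarrow> real^'k^'n \<Rightarrow> 'k::finite set set \<Rightarrow> real" where
  "tree_posterior \<delta> D x E =
     tree_prior E * marginal_likelihood \<delta> D x E /
     (\<Sum>E'\<in>trees. tree_prior E' * marginal_likelihood \<delta> D x E')"

definition edge_probability ::
    "real \<Rightarrow> real^'k^'k \<Rightarrow> real^'k^'n \<Rightarrow> 'k::finite \<Rightarrow> 'k \<Rightarrow> real" where
  "edge_probability \<delta> D x i j = (\<Sum>E | E \<in> trees \<and> {i, j} \<in> E. tree_posterior \<delta> D x E)"

definition g_factor :: "real \<Rightarrow> real^'k^'k \<Rightarrow> 'k \<Rightarrow> 'k \<Rightarrow> real" where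
  "g_factor \<delta> D i j =
     Gamma ((\<delta> + 1) / 2) * (D $ i $ i * D $ j $ j) powr (\<delta> / 2) /
     (Gamma (\<delta> / 2) * principal_minor D {i, j} powr ((\<delta> + 1) / 2))"

definition weight :: "real \<Rightarrow> real^'k^'k \<Rightarrow> real^'k^'n \<Rightarrow> 'k \<Rightarrow> 'k \<Rightarrow> real" where
  "weight \<delta> D x i j = g_factor (\<delta> + real CARD('n)) (D + transpose x ** x) i j / g_factor \<delta> D i j"

definition laplacian :: "('k \<Rightarrow> 'k \<Rightarrow> real) \<Rightarrow> real^'k^'k" where
  "laplacian w = (\<chi> i j. if i = j then \<Sum>l\<in>UNIV - {i}. w i l else - w i j)"

definition resistance :: "('k::finite \<Rightarrow> 'k \<Rightarrow> real) \<Rightarrow> 'k \<Rightarrow> 'k \<Rightarrow> real" where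
  "resistance w i j =
     principal_minor (laplacian w) (UNIV - {i, j}) / principal_minor (laplacian w) (UNIV - {i})"

definition set_weight :: "'k \<Rightarrow> 'k \<Rightarrow> real \<Rightarrow> ('k \<Rightarrow> 'k \<Rightarrow> real) \<Rightarrow> 'k \<Rightarrow> 'k \<Rightarrow> real" where
  "set_weight i j t w = (\<lambda>a b. if {a, b} = {i, j} then t else w a b)"

end

theory Submission
  imports Defs "HOL-Probability.Distributions"
begin

text \<open>
  Orient every tree towards a root \<open>r\<close>, so that a tree becomes a map sending each vertex to its parent.
  Eliminating a leaf \<open>v\<close> with parent \<open>u\<close> from a matrix with the sparsity pattern of the tree splits off
  a Gaussian integral over the entry \<open>{u, v}\<close> and a Gamma integral over the entry \<open>{v}\<close>, and merely
  translates the entry \<open>{u}\<close>. Iterating, the Hyper-Wishart normalizing constant is, up to a factor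
  independent of the tree, the product of the \<open>g_factor\<close> over the edges, so the posterior of
  a tree is proportional to the product of its edge weights. By the matrix-tree theorem the total
  weight of all trees is the principal minor of the Laplacian at \<open>UNIV - {i}\<close>; giving \<open>j\<close> the single outgoing
  edge to \<open>i\<close> in the same (directed) theorem yields the weight of the trees through \<open>{i, j}\<close>. As
  a function of \<open>t = w\<^bsub>ij\<^esub>\<close> the quotient is \<open>t A / (t A + B)\<close> with \<open>A > 0\<close> and \<open>B \<ge> 0\<close>, where \<open>B > 0\<close>
  as soon as some tree avoids \<open>{i, j}\<close>.
\<close>

section \<open>Determinants\<close>

text \<open>The level function \<open>l\<close> stands in for an ordering of the index type. If a
  permutation other than \<open>id\<close> had only nonzero entries, a moved index of least level
  would be sent to another moved index of lower level; hence only \<open>id\<close> survives in the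
  Leibniz sum.\<close>

lemma det_triangular_level:
  fixes A :: "'a::comm_ring_1^'k^'k" and l :: "'k \<Rightarrow> nat"
  assumes "\<And>i j. i \<noteq> j \<Longrightarrow> A $ i $ j \<noteq> 0 \<Longrightarrow> l j < l i"
  shows "det A = (\<Prod>i\<in>UNIV. A $ i $ i)"
proof -
  have zero: "(\<Prod>i\<in>UNIV. A $ i $ p i) = 0" if p: "p permutes UNIV" and "p \<noteq> id" for p
  proof (rule ccontr)
    assume nz: "(\<Prod>i\<in>UNIV. A $ i $ p i) \<noteq> 0"
    have entry: "A $ i $ p i \<noteq> 0" for i
      using nz by (metis UNIV_I finite_class.finite_UNIV prod_zero)
    obtain i0 where "p i0 \<noteq> i0" using \<open>p \<noteq> id\<close> by (metis eq_id_iff)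
    then obtain i where i: "p i \<noteq> i" and min: "\<And>y. p y \<noteq> y \<Longrightarrow> l i \<le> l y"
      using ex_has_least_nat[of "\<lambda>i. p i \<noteq> i" i0 l] by auto
    have "l (p i) < l i" using assms[of i "p i"] entry[of i] i by auto
    moreover have "p (p i) \<noteq> p i"
      using i permutes_inj[OF p] by (simp add: inj_eq)
    ultimately show False using min[of "p i"] by simp
  qed
  have "det A = (\<Sum>p | p permutes UNIV. of_int (sign p) * (\<Prod>i\<in>UNIV. A $ i $ p i))"
    by (simp add: det_def)
  also have "\<dots> = (\<Sum>p\<in>{id}. of_int (sign p) * (\<Prod>i\<in>UNIV. A $ i $ p i))"
    by (rule sum.mono_neutral_right) (auto simp: permutes_id zero)
  finally show ?thesis by (simp add: sign_id)
qed

lemma principal_minor_cong: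
  assumes "\<And>i j. i \<in> I \<Longrightarrow> j \<in> I \<Longrightarrow> A $ i $ j = B $ i $ j"
  shows "principal_minor A I = principal_minor B I"
  unfolding principal_minor_def
  by (intro sum.cong arg_cong2[where f="(*)"] prod.cong refl) (auto simp: assms permutes_in_image)

text \<open>Laplace expansion along a row whose only nonzero entry within \<open>I\<close> is
  diagonal: a permutation of \<open>I\<close> that moves \<open>j\<close> picks up a zero, and those
  fixing \<open>j\<close> are exactly the permutations of \<open>I - {j}\<close>.\<close>

lemma principal_minor_remove:
  fixes A :: "real^'k^'k"
  assumes j: "j \<in> I" and zero: "\<And>m. m \<in> I \<Longrightarrow> m \<noteq> j \<Longrightarrow> A $ j $ m = 0"
  shows "principal_minor A I = A $ j $ j * principal_minor A (I - {j})"
proof -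
  have fin: "finite I" by simp
  have sub: "{p. p permutes (I - {j})} \<subseteq> {p. p permutes I}"
    by (auto intro: permutes_subset)
  have vanish: "of_int (sign p) * (\<Prod>i\<in>I. A $ i $ p i) = 0"
    if "p \<in> {p. p permutes I} - {p. p permutes (I - {j})}" for p
  proof -
    have p: "p permutes I" and np: "\<not> p permutes (I - {j})" using that by auto
    have "p j \<noteq> j"
    proof
      assume "p j = j"
      then have "p permutes (I - {j})"
        using p by (intro permutes_superset[OF p]) auto
      with np show False ..
    qed
    moreover have "p j \<in> I" using p j by (simp add: permutes_in_image)
    ultimately have "A $ j $ p j = 0" using zero by auto
    then have "(\<Prod>i\<in>I. A $ i $ p i) = 0" using j fin by (meson prod_zero)
    then show ?thesis by simp
  qed
  have fins: "finite {p. p permutes I}" by (rule finite_permutations[OF fin])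
  have "principal_minor A I = (\<Sum>p | p permutes (I - {j}). of_int (sign p) * (\<Prod>i\<in>I. A $ i $ p i))"
    unfolding principal_minor_def
    by (rule sum.mono_neutral_right[OF fins sub]) (use vanish in blast)
  also have "\<dots> = (\<Sum>p | p permutes (I - {j}).
      A $ j $ j * (of_int (sign p) * (\<Prod>i\<in>I - {j}. A $ i $ p i)))"
  proof (intro sum.cong refl)
    fix p assume "p \<in> {p. p permutes (I - {j})}"
    then have "p j = j" by (auto simp: permutes_def)
    then show "of_int (sign p) * (\<Prod>i\<in>I. A $ i $ p i) =
      A $ j $ j * (of_int (sign p) * (\<Prod>i\<in>I - {j}. A $ i $ p i))"
      using prod.remove[OF fin j, of "\<lambda>i. A $ i $ p i"] by simp
  qed
  finally show ?thesis by (simp add: principal_minor_def sum_distrib_left)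
qed

section \<open>The matrix-tree theorem\<close>

text \<open>A spanning tree is encoded by its orientation towards the root \<open>r\<close>.\<close>

definition parent_map :: "'k \<Rightarrow> ('k \<Rightarrow> 'k) \<Rightarrow> bool" where
  "parent_map r f \<longleftrightarrow> f r = r \<and> (\<exists>l :: 'k \<Rightarrow> nat. \<forall>v. v \<noteq> r \<longrightarrow> l (f v) < l v)"

lemma parent_map_fixed_iff: "parent_map r f \<Longrightarrow> f v = v \<longleftrightarrow> v = r"
  unfolding parent_map_def by (cases "v = r") (auto dest: spec[of _ v])

text \<open>If levels decrease along \<open>f\<close>, the matrix is triangular with unit diagonal.
  Otherwise some vertices never reach \<open>r\<close> under iteration of \<open>f\<close>, and the
  indicator vector of their set lies in the kernel.\<close>

lemma det_parent_map:
  fixes r :: "'k::finite"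
  assumes r: "f r = r"
  shows "det (\<chi> v. if v = r then axis r 1 else axis v 1 - axis (f v) 1 :: real^'k^'k) =
    (if parent_map r f then 1 else 0)" (is "det ?A = _")
proof (cases "parent_map r f")
  case True
  then obtain l :: "'k \<Rightarrow> nat" where l: "\<And>v. v \<noteq> r \<Longrightarrow> l (f v) < l v"
    unfolding parent_map_def by blast
  have "det ?A = (\<Prod>i\<in>UNIV. ?A $ i $ i)"
    by (rule det_triangular_level[where l = l]) (auto simp: axis_def l split: if_splits)
  also have "\<dots> = 1"
  proof (rule prod.neutral, rule ballI)
    fix v :: 'k
    show "?A $ v $ v = 1"
      using parent_map_fixed_iff[OF True, of v] by (cases "v = r") (simp_all add: axis_def eq_commute)
  qed
  finally show ?thesis using True by simp
next
  case False
  define C where "C = {v. \<forall>n. (f ^^ n) v \<noteq> r}"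
  have step: "f v \<in> C \<longleftrightarrow> v \<in> C" if "v \<noteq> r" for v
  proof
    assume "f v \<in> C"
    have "(f ^^ n) v \<noteq> r" for n
      using \<open>f v \<in> C\<close> that by (cases n) (auto simp: C_def funpow_Suc_right simp del: funpow.simps)
    then show "v \<in> C" by (simp add: C_def)
  next
    assume "v \<in> C"
    then have "(f ^^ Suc n) v \<noteq> r" for n by (simp add: C_def del: funpow.simps)
    then show "f v \<in> C" by (simp add: C_def funpow_Suc_right del: funpow.simps)
  qed
  have "C \<noteq> {}"
  proof
    assume "C = {}"
    then have ex: "\<exists>n. (f ^^ n) v = r" for v by (auto simp: C_def)
    \<comment> \<open>If every orbit reached \<open>r\<close>, the number of steps needed would be a
      level function, contradicting the case assumption.\<close>
    define l where "l v = (LEAST n. (f ^^ n) v = r)" for v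
    have "l (f v) < l v" if "v \<noteq> r" for v
    proof -
      have hit: "(f ^^ l v) v = r" unfolding l_def by (rule LeastI_ex[OF ex])
      with that obtain n where n: "l v = Suc n" by (cases "l v") auto
      with hit have "(f ^^ n) (f v) = r" by (simp add: funpow_Suc_right del: funpow.simps)
      then have "l (f v) \<le> n" unfolding l_def by (rule Least_le)
      with n show ?thesis by simp
    qed
    with False r show False by (auto simp: parent_map_def)
  qed
  have rC: "r \<notin> C" by (auto simp: C_def intro: exI[of _ 0])
  define x :: "real^'k" where "x = (\<chi> v. if v \<in> C then 1 else 0)"
  have "x \<noteq> 0" using \<open>C \<noteq> {}\<close> by (auto simp: x_def vec_eq_iff)
  moreover have "?A *v x = 0"
  proof -
    have "(?A *v x) $ v = 0" for v
    proof (cases "v = r")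
      case True
      then show ?thesis using rC
        by (simp add: matrix_vector_mul_component inner_axis' x_def)
    next
      case False
      then show ?thesis using step[OF False]
        by (simp add: matrix_vector_mul_component inner_axis' inner_diff_left x_def)
    qed
    then show ?thesis by (simp add: vec_eq_iff)
  qed
  ultimately have "\<not> (\<forall>x. ?A *v x = 0 \<longrightarrow> x = 0)" by blast
  then have "\<not> invertible ?A"
    unfolding invertible_left_inverse matrix_left_invertible_ker .
  then show ?thesis using False invertible_det_nz[of ?A] by simp
qed

text \<open>Replace row \<open>r\<close> of the Laplacian by a unit vector and write every other row
  \<open>v\<close> as a sum of vectors \<open>w v m *s (axis v 1 - axis m 1)\<close>. Multilinearity
  turns the determinant into a sum over all maps \<open>f\<close>, from which
  \<open>det_parent_map\<close> selects the trees. Symmetry of \<open>w\<close> is not assumed,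
  which \<open>matrix_tree_edge\<close> exploits.\<close>

lemma matrix_tree:
  fixes w :: "'k::finite \<Rightarrow> 'k \<Rightarrow> real"
  shows "principal_minor (laplacian w) (UNIV - {r}) =
    (\<Sum>f | parent_map r f. \<Prod>v\<in>UNIV - {r}. w v (f v))"
proof -
  \<comment> \<open>In row \<open>r\<close> only the summand \<open>m = r\<close> is nonzero, so
    maps moving the root drop out. In the other rows the summand \<open>m = v\<close> is zero, in
    agreement with the Laplacian ignoring \<open>w v v\<close>.\<close>
  define a :: "'k \<Rightarrow> 'k \<Rightarrow> real^'k" where
    "a v m = (if v = r then (if m = r then axis r 1 else 0) else w v m *s (axis v 1 - axis m 1))" for v m
  define c where "c f v = (if v = r then (if f r = r then 1 else 0) else w v (f v))" for f v
  define b :: "('k \<Rightarrow> 'k) \<Rightarrow> 'k \<Rightarrow> real^'k" where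
    "b f v = (if v = r then axis r 1 else axis v 1 - axis (f v) 1)" for f v
  let ?B = "(\<chi> v. sum (a v) UNIV) :: real^'k^'k"
  have row_r: "?B $ r = axis r 1"
    by (simp add: a_def)
  have entry: "?B $ v $ k = laplacian w $ v $ k" if "v \<noteq> r" for v k
  proof -
    have "?B $ v $ k = (\<Sum>m\<in>UNIV. w v m * ((if k = v then 1 else 0) - (if k = m then 1 else 0)))"
      using that by (cases "k = v") (simp_all add: a_def axis_def right_diff_distrib)
    also have "\<dots> = (\<Sum>m\<in>UNIV. w v m * (if k = v then 1 else 0)) - (\<Sum>m\<in>UNIV. w v m * (if k = m then 1 else 0))"
      by (simp only: right_diff_distrib sum_subtractf)
    also have "\<dots> = (if k = v then \<Sum>m\<in>UNIV. w v m else 0) - w v k"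
      by (simp add: mult_delta_right)
    also have "\<dots> = laplacian w $ v $ k"
      by (simp add: laplacian_def sum_diff1)
    finally show ?thesis .
  qed
  have "principal_minor (laplacian w) (UNIV - {r}) = principal_minor ?B (UNIV - {r})"
    by (rule principal_minor_cong) (use entry in auto)
  also have "\<dots> = principal_minor ?B UNIV"
    using principal_minor_remove[of r UNIV ?B] unfolding row_r by (simp add: axis_def)
  also have "\<dots> = det ?B" by (rule principal_minor_UNIV)
  also have "\<dots> = (\<Sum>f\<in>UNIV. det (\<chi> v. a v (f v)))"
    by (subst det_linear_rows_sum) auto
  also have "\<dots> = (\<Sum>f\<in>UNIV. prod (c f) UNIV * det (\<chi> v. b f v))"
  proof (rule sum.cong[OF refl])
    fix f :: "'k \<Rightarrow> 'k"
    have "a v (f v) = c f v *s b f v" for v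
      by (simp add: a_def b_def c_def)
    then show "det (\<chi> v. a v (f v)) = prod (c f) UNIV * det (\<chi> v. b f v)"
      using det_rows_mul[of "c f" "b f"] by simp
  qed
  also have "\<dots> = (\<Sum>f\<in>UNIV. if parent_map r f then \<Prod>v\<in>UNIV - {r}. w v (f v) else 0)"
  proof (rule sum.cong[OF refl])
    fix f :: "'k \<Rightarrow> 'k"
    have "prod (c f) UNIV = c f r * prod (c f) (UNIV - {r})"
      by (rule prod.remove) auto
    also have "prod (c f) (UNIV - {r}) = (\<Prod>v\<in>UNIV - {r}. w v (f v))"
      by (rule prod.cong) (auto simp: c_def)
    finally have c: "prod (c f) UNIV = c f r * (\<Prod>v\<in>UNIV - {r}. w v (f v))" .
    show "prod (c f) UNIV * det (\<chi> v. b f v) =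
      (if parent_map r f then \<Prod>v\<in>UNIV - {r}. w v (f v) else 0)"
    proof (cases "f r = r")
      case True
      then show ?thesis using det_parent_map[of f r, OF True] unfolding c by (simp add: c_def b_def)
    next
      case False
      then show ?thesis unfolding c by (simp add: c_def parent_map_def)
    qed
  qed
  finally show ?thesis by (simp add: sum.If_cases)
qed

text \<open>Delete all edges leaving \<open>j\<close> except the one to \<open>r\<close>. On the
  tree side only maps with \<open>f j = r\<close> keep a nonzero product; on the determinant side
  row \<open>j\<close> is left with the single entry \<open>w j r\<close> on the diagonal and can be
  split off.\<close>

lemma matrix_tree_edge:
  fixes w :: "'k::finite \<Rightarrow> 'k \<Rightarrow> real"
  assumes "r \<noteq> j"
  shows "w j r * principal_minor (laplacian w) (UNIV - {r, j}) =
    (\<Sum>f | parent_map r f \<and> f j = r. \<Prod>v\<in>UNIV - {r}. w v (f v))"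
proof -
  define w' where "w' v m = (if v = j \<and> m \<noteq> r then 0 else w v m)" for v m
  have jj: "laplacian w' $ j $ j = w j r"
  proof -
    have "laplacian w' $ j $ j = (\<Sum>l\<in>UNIV - {j}. w' j l)"
      by (simp add: laplacian_def)
    also have "\<dots> = w' j r + (\<Sum>l\<in>UNIV - {j} - {r}. w' j l)"
      using assms by (intro sum.remove) auto
    also have "\<dots> = w j r" by (simp add: w'_def)
    finally show ?thesis .
  qed
  have off: "laplacian w' $ j $ m = 0" if "m \<noteq> j" "m \<noteq> r" for m
    using that by (simp add: laplacian_def w'_def)
  have "laplacian w $ v $ m = laplacian w' $ v $ m" if "v \<noteq> j" for v m
    using that by (auto simp: laplacian_def w'_def)
  then have "principal_minor (laplacian w) (UNIV - {r} - {j}) =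
      principal_minor (laplacian w') (UNIV - {r} - {j})"
    by (intro principal_minor_cong) auto
  moreover have "UNIV - {r, j} = UNIV - {r} - {j}" by auto
  ultimately have "w j r * principal_minor (laplacian w) (UNIV - {r, j}) =
      w j r * principal_minor (laplacian w') (UNIV - {r} - {j})"
    by simp
  also have "\<dots> = principal_minor (laplacian w') (UNIV - {r})"
    using assms by (subst principal_minor_remove[of j "UNIV - {r}"]) (auto simp: jj off)
  also have "\<dots> = (\<Sum>f | parent_map r f. \<Prod>v\<in>UNIV - {r}. w' v (f v))"
    by (rule matrix_tree)
  also have "\<dots> = (\<Sum>f | parent_map r f \<and> f j = r. \<Prod>v\<in>UNIV - {r}. w' v (f v))"
  proof (rule sum.mono_neutral_right)
    show "\<forall>f\<in>{f. parent_map r f} - {f. parent_map r f \<and> f j = r}. (\<Prod>v\<in>UNIV - {r}. w' v (f v)) = 0"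
      using assms by (auto simp: w'_def intro!: prod_zero bexI[of _ j])
  qed auto
  also have "\<dots> = (\<Sum>f | parent_map r f \<and> f j = r. \<Prod>v\<in>UNIV - {r}. w v (f v))"
    by (intro sum.cong prod.cong) (auto simp: w'_def)
  finally show ?thesis .
qed

section \<open>Trees as parent maps\<close>

definition edges_of :: "'k \<Rightarrow> ('k \<Rightarrow> 'k) \<Rightarrow> 'k set set" where
  "edges_of r f = (\<lambda>v. {v, f v}) ` (UNIV - {r})"

lemma edges_of_iff:
  "{a, b} \<in> edges_of r f \<longleftrightarrow> a \<noteq> r \<and> f a = b \<or> b \<noteq> r \<and> f b = a"
  by (auto simp: edges_of_def doubleton_eq_iff)

lemma edges_of_inj: "inj_on (edges_of r) {f. parent_map r f}"
proof (rule inj_onI, rule ccontr)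
  fix f g assume "f \<in> {f. parent_map r f}" "g \<in> {f. parent_map r f}"
    and eq: "edges_of r f = edges_of r g" and "f \<noteq> g"
  then obtain lf lg :: "'a \<Rightarrow> nat"
    where lf: "\<And>v. v \<noteq> r \<Longrightarrow> lf (f v) < lf v" and lg: "\<And>v. v \<noteq> r \<Longrightarrow> lg (g v) < lg v"
      and r: "f r = r" "g r = r"
    unfolding parent_map_def by blast
  have swap: "f v \<noteq> r \<and> g (f v) = v \<and> f (f v) \<noteq> g (f v)" if "f v \<noteq> g v" for v
  proof -
    have v: "v \<noteq> r" using that r by auto
    then have "{v, f v} \<in> edges_of r g" unfolding eq[symmetric] by (auto simp: edges_of_def)
    then have *: "f v \<noteq> r" "g (f v) = v" using that by (auto simp: edges_of_iff)
    with lf[OF v] lf[of "f v"] show ?thesis by auto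
  qed
  text \<open>Along \<open>f\<close> the maps keep differing, while \<open>g\<close> runs in the opposite direction, so the
    \<open>f\<close>-level decreases forever.\<close>
  have "f v \<noteq> g v \<longrightarrow> False" for v
  proof (induction "lf v" arbitrary: v rule: less_induct)
    case less
    show ?case
    proof
      assume d: "f v \<noteq> g v"
      then have "v \<noteq> r" using r by auto
      with less[OF lf[OF this]] swap[OF d] show False by auto
    qed
  qed
  with \<open>f \<noteq> g\<close> show False by blast
qed

text \<open>Distinctness is what lets such a path be closed to a cycle later. When the new first
  vertex already occurs on the path, the suffix starting there is used instead.\<close>

lemma rtrancl_distinct_path:
  assumes "(a, b) \<in> R\<^sup>*"
  shows "\<exists>xs. xs \<noteq> [] \<and> hd xs = a \<and> last xs = b \<and> distinct xs \<and>
    (\<forall>m. Suc m < length xs \<longrightarrow> (xs ! m, xs ! Suc m) \<in> R)"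
  using assms
proof (induction rule: converse_rtrancl_induct)
  case base
  show ?case by (rule exI[of _ "[b]"]) auto
next
  case (step a c)
  then obtain xs where xs: "xs \<noteq> []" "hd xs = c" "last xs = b" "distinct xs"
    and R: "\<And>m. Suc m < length xs \<Longrightarrow> (xs ! m, xs ! Suc m) \<in> R"
    by auto
  show ?case
  proof (cases "a \<in> set xs")
    case False
    have "((a # xs) ! m, (a # xs) ! Suc m) \<in> R" if "Suc m < length (a # xs)" for m
      using that R xs(1,2) step(1) by (cases m) (auto simp: hd_conv_nth)
    with False xs show ?thesis by (intro exI[of _ "a # xs"]) auto
  next
    case True
    then obtain k where k: "k < length xs" "xs ! k = a" by (auto simp: in_set_conv_nth)
    with xs R show ?thesis
      by (intro exI[of _ "drop k xs"]) (auto simp: hd_drop_conv_nth)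
  qed
qed

lemma edges_of_connected:
  assumes "parent_map r f"
  shows "connected_graph (edges_of r f)"
proof -
  let ?R = "{(a, b). {a, b} \<in> edges_of r f}"
  from assms obtain l :: "'a \<Rightarrow> nat" where l: "\<And>v. v \<noteq> r \<Longrightarrow> l (f v) < l v"
    unfolding parent_map_def by blast
  have to_root: "(v, r) \<in> ?R\<^sup>*" for v
  proof (induction "l v" arbitrary: v rule: less_induct)
    case less
    show ?case
    proof (cases "v = r")
      case False
      then have "(v, f v) \<in> ?R" by (auto simp: edges_of_def)
      with less[OF l[OF False]] show ?thesis by (rule converse_rtrancl_into_rtrancl[rotated])
    qed auto
  qed
  have "sym ?R" by (auto simp: sym_def insert_commute)
  then have "sym (?R\<^sup>*)" by (rule sym_rtrancl)
  then have "(r, v) \<in> ?R\<^sup>*" for v using to_root by (auto dest: symD)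
  then show ?thesis unfolding connected_graph_def using to_root rtrancl_trans by metis
qed

lemma edges_of_acyclic:
  assumes "parent_map r f"
  shows "\<not> is_cycle (edges_of r f) c"
proof
  assume "is_cycle (edges_of r f) c"
  then have len: "3 \<le> length c" and dist: "distinct c"
    and edge: "\<And>m. m < length c \<Longrightarrow> {c ! m, c ! (Suc m mod length c)} \<in> edges_of r f"
    by (auto simp: is_cycle_def)
  from assms obtain l :: "'a \<Rightarrow> nat" where l: "\<And>v. v \<noteq> r \<Longrightarrow> l (f v) < l v"
    unfolding parent_map_def by blast
  text \<open>At a vertex of maximal level, both neighbours on the cycle must be the parent.\<close>
  let ?L = "(\<lambda>k. l (c ! k)) ` {..<length c}"
  have "Max ?L \<in> ?L" using len by (intro Max_in) (auto simp: lessThan_empty_iff)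
  then obtain m where m: "m < length c" and "l (c ! m) = Max ?L" by auto
  then have max: "l (c ! k) \<le> l (c ! m)" if "k < length c" for k
    using that by (auto intro!: Max_ge)
  define s where "s = Suc m mod length c"
  \<comment> \<open>\<open>p\<close> is the cyclic predecessor of \<open>m\<close> and
    \<open>s\<close> its successor; they differ because a cycle has at least three vertices.\<close>
  define p where "p = (if m = 0 then length c - 1 else m - 1)"
  have sp: "s < length c" "p < length c" "Suc p mod length c = m"
    using len m by (auto simp: s_def p_def intro!: mod_less_divisor)
  have "s \<noteq> p"
    using len m by (cases "Suc m = length c") (auto simp: s_def p_def split: if_splits)
  have parent: "f (c ! m) = c ! k" if "k < length c" "{c ! m, c ! k} \<in> edges_of r f" for k
    using that max[OF that(1)] l[of "c ! k"] by (auto simp: edges_of_iff)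
  have "f (c ! m) = c ! s" using parent[OF sp(1)] edge[OF m] by (simp add: s_def)
  moreover have "f (c ! m) = c ! p"
    using parent[OF sp(2)] edge[OF sp(2)] sp(3) by (simp add: insert_commute)
  ultimately show False using dist sp \<open>s \<noteq> p\<close> nth_eq_iff_index_eq by metis
qed

lemma edges_of_tree:
  fixes r :: "'k::finite"
  assumes "parent_map r f"
  shows "edges_of r f \<in> trees"
proof -
  have "card e = 2" if e: "e \<in> edges_of r f" for e
  proof -
    obtain v where "v \<noteq> r" "e = {v, f v}" using e by (auto simp: edges_of_def)
    then show ?thesis using parent_map_fixed_iff[OF assms, of v] by auto
  qed
  then show ?thesis
    unfolding trees_def using edges_of_connected[OF assms] edges_of_acyclic[OF assms] by blast
qed

text \<open>Let each vertex point to a neighbour nearer to \<open>r\<close>. This gives a connected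
  subgraph of \<open>E\<close>, and any further edge of \<open>E\<close> would close a cycle with
  the path that joins its ends in the subgraph.\<close>

lemma tree_has_parent_map:
  fixes r :: "'k::finite"
  assumes "E \<in> trees"
  shows "\<exists>f. parent_map r f \<and> edges_of r f = E"
proof -
  let ?R = "{(a, b). {a, b} \<in> E}"
  have card: "\<And>e. e \<in> E \<Longrightarrow> card e = 2" and conn: "\<And>u v. (u, v) \<in> ?R\<^sup>*"
    and acyc: "\<And>c. \<not> is_cycle E c"
    using assms by (auto simp: trees_def connected_graph_def)
  \<comment> \<open>The graph distance from \<open>v\<close> to the root.\<close>
  define l where "l v = (LEAST n. (v, r) \<in> ?R ^^ n)" for v
  have hit: "(v, r) \<in> ?R ^^ l v" for v
    unfolding l_def by (rule LeastI_ex) (use conn rtrancl_power in metis)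
  have "\<exists>u. {v, u} \<in> E \<and> l u < l v" if "v \<noteq> r" for v
  proof -
    from that hit[of v] obtain n where n: "l v = Suc n" by (cases "l v") auto
    with hit[of v] obtain u where u: "(v, u) \<in> ?R" "(u, r) \<in> ?R ^^ n"
      by (metis relpow_Suc_D2)
    from u(2) have "l u \<le> n" unfolding l_def by (rule Least_le)
    with u n show ?thesis by auto
  qed
  then obtain f0 where f0: "\<And>v. v \<noteq> r \<Longrightarrow> {v, f0 v} \<in> E \<and> l (f0 v) < l v" by metis
  define f where "f = f0(r := r)"
  have f: "parent_map r f" using f0 by (auto simp: parent_map_def f_def)
  have sub: "edges_of r f \<subseteq> E" using f0 by (auto simp: edges_of_def f_def)
  have "e \<in> edges_of r f" if e: "e \<in> E" for e
  proof (rule ccontr)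
    assume out: "e \<notin> edges_of r f"
    obtain a b where ab: "e = {a, b}" "a \<noteq> b" using card[OF e] by (auto simp: card_2_iff)
    have "(a, b) \<in> {(a, b). {a, b} \<in> edges_of r f}\<^sup>*"
      using edges_of_connected[OF f] by (auto simp: connected_graph_def)
    from rtrancl_distinct_path[OF this] obtain xs where
      xs: "xs \<noteq> []" "hd xs = a" "last xs = b" "distinct xs" and
      path: "\<And>m. Suc m < length xs \<Longrightarrow> {xs ! m, xs ! Suc m} \<in> edges_of r f"
      by auto
    have ends: "xs ! 0 = a" "xs ! (length xs - 1) = b"
      using xs by (auto simp: hd_conv_nth last_conv_nth)
    have "length xs \<noteq> 1" using ends ab by auto
    moreover have "length xs \<noteq> 2"
    proof
      assume "length xs = 2"
      with path[of 0] ends out ab show False by auto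
    qed
    \<comment> \<open>One vertex is excluded since \<open>a\<close> and \<open>b\<close> differ; two
      vertices would make \<open>e\<close> itself an edge of the parent map.\<close>
    ultimately have len: "3 \<le> length xs" using xs(1) by (cases "length xs") auto
    have "{xs ! m, xs ! (Suc m mod length xs)} \<in> E" if m: "m < length xs" for m
    proof (cases "Suc m < length xs")
      case True
      with path sub show ?thesis by auto
    next
      case False
      with m have last: "Suc m = length xs" by simp
      then have "m = length xs - 1" by simp
      with ends e ab last show ?thesis by (simp add: insert_commute)
    qed
    with len xs(4) acyc show False by (auto simp: is_cycle_def)
  qed
  with sub f show ?thesis by blast
qed

lemma edges_of_bij:
  fixes r :: "'k::finite"
  shows "bij_betw (edges_of r) {f. parent_map r f} trees"
  unfolding bij_betw_def
  using edges_of_inj edges_of_tree tree_has_parent_map by fastforce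

section \<open>Positive definite matrices\<close>

lemma pos_def_congruence_imp:
  fixes A L :: "real^'k^'k"
  assumes "pos_def A" and "invertible L"
  shows "pos_def (transpose L ** A ** L)"
  unfolding pos_def_def
proof (intro conjI allI impI)
  show "transpose (transpose L ** A ** L) = transpose L ** A ** L"
    using assms(1) by (simp add: pos_def_def matrix_transpose_mul matrix_mul_assoc)
  fix y :: "real^'k" assume "y \<noteq> 0"
  have "L *v y \<noteq> 0"
    using \<open>y \<noteq> 0\<close> assms(2) unfolding invertible_left_inverse matrix_left_invertible_ker by blast
  then have "0 < (L *v y) \<bullet> (A *v (L *v y))"
    using assms(1) by (simp add: pos_def_def)
  also have "\<dots> = y \<bullet> ((transpose L ** A ** L) *v y)"
    by (simp add: dot_lmul_matrix[symmetric] matrix_vector_mul_assoc[symmetric])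
      (metis dot_lmul_matrix transpose_transpose vector_transpose_matrix inner_commute)
  finally show "0 < y \<bullet> ((transpose L ** A ** L) *v y)" .
qed

lemma pos_def_congruence:
  fixes A L :: "real^'k^'k"
  assumes "invertible L"
  shows "pos_def (transpose L ** A ** L) \<longleftrightarrow> pos_def A"
proof
  assume pd: "pos_def (transpose L ** A ** L)"
  obtain K where K: "L ** K = mat 1" "K ** L = mat 1"
    using assms by (auto simp: invertible_def)
  then have KT: "transpose K ** transpose L = mat 1"
    by (metis matrix_transpose_mul transpose_mat)
  have "invertible K" using K by (auto simp: invertible_def)
  from pos_def_congruence_imp[OF pd this] have "pos_def (transpose K ** transpose L ** A ** (L ** K))"
    by (simp add: matrix_mul_assoc)
  then show "pos_def A" by (simp add: K KT)
qed (rule pos_def_congruence_imp[OF _ assms])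

lemma pos_def_mat1: "pos_def (mat 1)"
  by (simp add: pos_def_def)

lemma pos_def_diag:
  assumes "pos_def A"
  shows "0 < A $ i $ i"
proof -
  have "0 < axis i 1 \<bullet> (A *v axis i 1)"
    using assms by (simp add: pos_def_def axis_eq_0_iff)
  also have "\<dots> = A $ i $ i"
    by (simp add: inner_axis' matrix_vector_mult_basis column_def)
  finally show ?thesis .
qed

lemma pos_def_sym:
  assumes "pos_def A"
  shows "A $ i $ j = A $ j $ i"
proof -
  have "transpose A $ i $ j = A $ j $ i" by (simp add: transpose_def)
  with assms show ?thesis by (simp add: pos_def_def)
qed

text \<open>One pivoting step: \<open>B = transpose L ** A ** L\<close>, where \<open>L\<close> is
  the identity with row \<open>v\<close> replaced by \<open>q\<close>. This \<open>L\<close> is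
  triangular up to reordering and has determinant \<open>q v\<close>, so congruence preserves
  definiteness and scales the determinant by its square.\<close>

lemma pos_def_bordered:
  fixes A B :: "real^'k^'k" and q :: "'k \<Rightarrow> real"
  assumes A: "\<And>j. A $ v $ j = (if j = v then 1 else 0)" "\<And>j. A $ j $ v = (if j = v then 1 else 0)"
    and B: "\<And>i j. B $ i $ j = (if i = v \<or> j = v then 0 else A $ i $ j) + q i * q j"
    and q: "q v > 0"
  shows "det B = (q v)\<^sup>2 * det A" and "pos_def B \<longleftrightarrow> pos_def A"
proof -
  define L :: "real^'k^'k" where "L = (\<chi> i j. if i = v then q j else if i = j then 1 else 0)"
  have "det L = (\<Prod>i\<in>UNIV. L $ i $ i)"
    by (rule det_triangular_level[where l = "\<lambda>i. if i = v then 1 else 0"])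
      (auto simp: L_def split: if_splits)
  also have "\<dots> = (\<Prod>i\<in>UNIV. if i = v then q v else 1)"
    by (rule prod.cong) (auto simp: L_def)
  also have "\<dots> = q v" by simp
  finally have detL: "det L = q v" .
  have AL: "(A ** L) $ k $ j = (if k = v then q j else if j = v then 0 else A $ k $ j)" for k j
  proof -
    have "(A ** L) $ k $ j = A $ k $ v * L $ v $ j + (\<Sum>m\<in>UNIV - {v}. A $ k $ m * L $ m $ j)"
      by (simp add: matrix_matrix_mult_def sum.remove[of _ v])
    also have "(\<Sum>m\<in>UNIV - {v}. A $ k $ m * L $ m $ j) = (\<Sum>m\<in>UNIV - {v}. if m = j then A $ k $ j else 0)"
      by (rule sum.cong) (auto simp: L_def)
    finally show ?thesis using A by (auto simp: L_def)
  qed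
  have "B $ i $ j = (transpose L ** (A ** L)) $ i $ j" for i j
  proof -
    have "(transpose L ** (A ** L)) $ i $ j =
      L $ v $ i * (A ** L) $ v $ j + (\<Sum>m\<in>UNIV - {v}. L $ m $ i * (A ** L) $ m $ j)"
      unfolding matrix_matrix_mult_def[of "transpose L"]
      by (simp add: transpose_def sum.remove[of _ v])
    also have "(\<Sum>m\<in>UNIV - {v}. L $ m $ i * (A ** L) $ m $ j) =
      (\<Sum>m\<in>UNIV - {v}. if m = i then (A ** L) $ i $ j else 0)"
      by (rule sum.cong) (auto simp: L_def)
    finally show ?thesis by (auto simp: B AL) (auto simp: L_def)
  qed
  then have BL: "B = transpose L ** A ** L"
    by (simp add: vec_eq_iff matrix_mul_assoc[symmetric])
  show "det B = (q v)\<^sup>2 * det A"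
    by (simp add: BL det_mul detL power2_eq_square)
  have "invertible L" using q by (simp add: invertible_det_nz detL)
  then show "pos_def B \<longleftrightarrow> pos_def A" unfolding BL by (rule pos_def_congruence)
qed

section \<open>Integrals\<close>

text \<open>Completing the square gives a multiple of the normal density with mean
  \<open>- \<beta> / c\<close> and variance \<open>1 / c\<close>.\<close>

lemma nn_integral_gaussian:
  fixes c \<beta> :: real
  assumes "c > 0"
  shows "(\<integral>\<^sup>+b. ennreal (exp (- (c * b\<^sup>2 + 2 * \<beta> * b) / 2)) \<partial>lborel) =
    ennreal (sqrt (2 * pi / c) * exp (\<beta>\<^sup>2 / (2 * c)))"
proof -
  let ?k = "sqrt (2 * pi / c) * exp (\<beta>\<^sup>2 / (2 * c))"
  let ?n = "normal_density (- \<beta> / c) (1 / sqrt c)"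
  have expo: "- (c * b\<^sup>2 + 2 * \<beta> * b) / 2 = \<beta>\<^sup>2 / (2 * c) + - (b - - \<beta> / c)\<^sup>2 / (2 * (1 / sqrt c)\<^sup>2)" for b
    using assms by (simp add: power_divide field_simps power2_eq_square)
  have eq: "exp (- (c * b\<^sup>2 + 2 * \<beta> * b) / 2) = ?k * ?n b" for b
    unfolding expo exp_add using assms
    by (simp add: normal_density_def power_divide real_sqrt_divide field_simps)
  have "(\<integral>\<^sup>+b. ennreal (?n b) \<partial>lborel) = 1"
    using assms by (subst nn_integral_eq_integral) (auto simp: normal_density_nonneg)
  moreover have "(\<integral>\<^sup>+b. ennreal (?k * ?n b) \<partial>lborel) = ennreal ?k * (\<integral>\<^sup>+b. ennreal (?n b) \<partial>lborel)"
    using assms by (subst nn_integral_cmult[symmetric]) (auto simp: ennreal_mult' normal_density_nonneg)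
  ultimately show ?thesis unfolding eq by simp
qed

text \<open>The Gamma integral after the substitution \<open>t = c * a\<close>; it is written
  \<open>0 + c * a\<close> to fit the affine substitution rule.\<close>

lemma nn_integral_gamma:
  fixes c k :: real
  assumes "c > 0" "k > 0"
  shows "(\<integral>\<^sup>+a. ennreal (if a > 0 then a powr (k - 1) * exp (- c * a) else 0) \<partial>lborel) =
    ennreal (Gamma k / c powr k)"
proof -
  let ?g = "\<lambda>t::real. ennreal (indicator {0..} t * t powr (k - 1) / exp t)"
  have eq: "ennreal (if a > 0 then a powr (k - 1) * exp (- c * a) else 0) =
      ennreal (c powr (1 - k)) * ?g (0 + c * a)" for a
  proof (cases "a > 0")
    case True
    then have "a powr (k - 1) * exp (- c * a) = c powr (1 - k) * ((c * a) powr (k - 1) / exp (c * a))"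
      using assms by (simp add: powr_mult exp_minus field_simps powr_add[symmetric])
    with True assms show ?thesis by (simp add: ennreal_mult'[symmetric])
  next
    case False
    with assms have "\<not> 0 < c * a" by (simp add: zero_less_mult_iff)
    with False show ?thesis by (auto simp: indicator_def)
  qed
  have "ennreal (Gamma k) = \<bar>c\<bar> * (\<integral>\<^sup>+a. ?g (0 + c * a) \<partial>lborel)"
    unfolding Gamma_conv_nn_integral_real[OF assms(2)]
    by (rule nn_integral_real_affine) (use assms in auto)
  then have "ennreal (c powr (- k)) * ennreal (Gamma k) =
      ennreal (c powr (- k)) * ennreal c * (\<integral>\<^sup>+a. ?g (0 + c * a) \<partial>lborel)"
    using assms by (simp add: mult.assoc)
  also have "ennreal (c powr (- k)) * ennreal c = ennreal (c powr (1 - k))"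
    using assms by (simp add: ennreal_mult'[symmetric] powr_mult_base mult.commute)
  also have "\<dots> * (\<integral>\<^sup>+a. ?g (0 + c * a) \<partial>lborel) =
      (\<integral>\<^sup>+a. ennreal (if a > 0 then a powr (k - 1) * exp (- c * a) else 0) \<partial>lborel)"
    unfolding eq by (rule nn_integral_cmult[symmetric]) measurable
  also have "ennreal (c powr (- k)) * ennreal (Gamma k) = ennreal (Gamma k / c powr k)"
    by (subst ennreal_mult'[symmetric]) (simp_all add: powr_minus divide_inverse mult.commute)
  finally show ?thesis ..
qed

text \<open>Isolate the coordinate \<open>e\<close> by Fubini and use translation invariance of
  \<open>lborel\<close> there. It removes the shift that pivoting causes in the diagonal entry of
  the parent.\<close>

lemma nn_integral_PiM_translate:
  fixes E :: "'e set" and t :: real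
  assumes fin: "finite E" and e: "e \<in> E"
    and g: "g \<in> borel_measurable (\<Pi>\<^sub>M i\<in>E. lborel)"
  shows "(\<integral>\<^sup>+\<theta>. g (\<theta>(e := \<theta> e + t)) \<partial>(\<Pi>\<^sub>M i\<in>E. lborel)) = (\<integral>\<^sup>+\<theta>. g \<theta> \<partial>(\<Pi>\<^sub>M i\<in>E. lborel))"
proof -
  interpret product_sigma_finite "\<lambda>_::'e. lborel :: real measure" by unfold_locales
  define E' where "E' = E - {e}"
  have E: "E = insert e E'" "finite E'" "e \<notin> E'" using fin e by (auto simp: E'_def)
  have shift: "(\<lambda>\<theta>. \<theta>(e := \<theta> e + t)) \<in> measurable (\<Pi>\<^sub>M i\<in>insert e E'. lborel) (\<Pi>\<^sub>M i\<in>insert e E'. lborel)"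
    by (rule measurable_fun_upd[where J = "insert e E'"]) auto
  note g' = g[unfolded E(1)]
  have "(\<integral>\<^sup>+\<theta>. g (\<theta>(e := \<theta> e + t)) \<partial>(\<Pi>\<^sub>M i\<in>insert e E'. lborel)) =
      (\<integral>\<^sup>+x. (\<integral>\<^sup>+y. g (x(e := y + t)) \<partial>lborel) \<partial>(\<Pi>\<^sub>M i\<in>E'. lborel))"
    by (subst product_nn_integral_insert[OF E(2,3)])
      (use measurable_compose[OF shift g'] in auto)
  also have "\<dots> = (\<integral>\<^sup>+x. (\<integral>\<^sup>+y. g (x(e := y)) \<partial>lborel) \<partial>(\<Pi>\<^sub>M i\<in>E'. lborel))"
  proof (rule nn_integral_cong)
    fix x assume x: "x \<in> space (\<Pi>\<^sub>M i\<in>E'. lborel :: real measure)"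
    have upd: "(\<lambda>y. x(e := y)) \<in> measurable lborel (\<Pi>\<^sub>M i\<in>insert e E'. lborel :: real measure)"
      using x by (intro measurable_fun_upd[where J = E']) auto
    have "(\<lambda>y. g (x(e := y))) \<in> borel_measurable borel"
      using measurable_compose[OF upd g'] by simp
    from nn_integral_real_affine[OF this, of 1 t]
    show "(\<integral>\<^sup>+y. g (x(e := y + t)) \<partial>lborel) = (\<integral>\<^sup>+y. g (x(e := y)) \<partial>lborel)"
      by (simp add: add.commute)
  qed
  also have "\<dots> = (\<integral>\<^sup>+\<theta>. g \<theta> \<partial>(\<Pi>\<^sub>M i\<in>insert e E'. lborel))"
    by (rule product_nn_integral_insert[OF E(2,3) g', symmetric])
  finally show ?thesis unfolding E(1) .
qed

text \<open>The inner integral is Gaussian with coefficient \<open>\<gamma> / a\<close>. Its factor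
  \<open>sqrt a\<close> raises the exponent of \<open>a\<close> by one half, and its exponential
  lowers the rate, leaving a Gamma integral of shape \<open>(\<delta> + 1) / 2\<close> and rate
  \<open>(\<alpha> * \<gamma> - \<beta>\<^sup>2) / (2 * \<gamma>)\<close>.\<close>

lemma nn_integral_edge:
  fixes \<alpha> \<beta> \<gamma> \<delta> :: real
  assumes "\<gamma> > 0" "\<alpha> * \<gamma> - \<beta>\<^sup>2 > 0" "\<delta> > 0"
  shows "(\<integral>\<^sup>+a. (\<integral>\<^sup>+b. ennreal (if a > 0 then a powr (\<delta> / 2 - 1) *
      exp (- (a * \<alpha> + 2 * b * \<beta> + b\<^sup>2 / a * \<gamma>) / 2) else 0) \<partial>lborel) \<partial>lborel) =
    ennreal (sqrt (2 * pi / \<gamma>) * (Gamma ((\<delta> + 1) / 2) /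
      ((\<alpha> * \<gamma> - \<beta>\<^sup>2) / (2 * \<gamma>)) powr ((\<delta> + 1) / 2)))"
    (is "(\<integral>\<^sup>+a. ?I a \<partial>_) = _")
proof -
  let ?c = "(\<alpha> * \<gamma> - \<beta>\<^sup>2) / (2 * \<gamma>)" and ?k = "(\<delta> + 1) / 2"
  have inner: "?I a = ennreal (sqrt (2 * pi / \<gamma>)) * ennreal (if a > 0 then a powr (?k - 1) * exp (- ?c * a) else 0)" for a
  proof (cases "a > 0")
    case True
    have split: "a powr (\<delta> / 2 - 1) * exp (- (a * \<alpha> + 2 * b * \<beta> + b\<^sup>2 / a * \<gamma>) / 2) =
        (a powr (\<delta> / 2 - 1) * exp (- a * \<alpha> / 2)) * exp (- (\<gamma> / a * b\<^sup>2 + 2 * \<beta> * b) / 2)" for b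
      by (simp add: exp_add[symmetric] mult.assoc field_simps)
    have "?I a = ennreal (a powr (\<delta> / 2 - 1) * exp (- a * \<alpha> / 2)) *
        (\<integral>\<^sup>+b. ennreal (exp (- (\<gamma> / a * b\<^sup>2 + 2 * \<beta> * b) / 2)) \<partial>lborel)"
      unfolding split using True by (subst nn_integral_cmult[symmetric]) (auto simp: ennreal_mult')
    also have "\<dots> = ennreal ((a powr (\<delta> / 2 - 1) * exp (- a * \<alpha> / 2)) *
        (sqrt (2 * pi / (\<gamma> / a)) * exp (\<beta>\<^sup>2 / (2 * (\<gamma> / a)))))"
      using True assms(1) by (subst nn_integral_gaussian) (auto simp: ennreal_mult')
    also have "(a powr (\<delta> / 2 - 1) * exp (- a * \<alpha> / 2)) *
        (sqrt (2 * pi / (\<gamma> / a)) * exp (\<beta>\<^sup>2 / (2 * (\<gamma> / a)))) =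
        sqrt (2 * pi / \<gamma>) * ((a powr (\<delta> / 2 - 1) * sqrt a) * (exp (- a * \<alpha> / 2) * exp (\<beta>\<^sup>2 / (2 * (\<gamma> / a)))))"
      by (simp add: real_sqrt_mult real_sqrt_divide)
    also have "a powr (\<delta> / 2 - 1) * sqrt a = a powr (?k - 1)"
      using True by (simp add: powr_half_sqrt[symmetric] powr_add[symmetric] field_simps)
    also have "exp (- a * \<alpha> / 2) * exp (\<beta>\<^sup>2 / (2 * (\<gamma> / a))) = exp (- ?c * a)"
      using assms(1) by (simp add: exp_add[symmetric] field_simps)
    finally show ?thesis using True assms(1) by (simp add: ennreal_mult')
  qed auto
  have "(\<integral>\<^sup>+a. ?I a \<partial>lborel) = ennreal (sqrt (2 * pi / \<gamma>)) *
      (\<integral>\<^sup>+a. ennreal (if a > 0 then a powr (?k - 1) * exp (- ?c * a) else 0) \<partial>lborel)"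
    unfolding inner by (rule nn_integral_cmult) measurable
  also have "\<dots> = ennreal (sqrt (2 * pi / \<gamma>)) * ennreal (Gamma ?k / ?c powr ?k)"
    using assms by (subst nn_integral_gamma) auto
  also have "\<dots> = ennreal (sqrt (2 * pi / \<gamma>) * (Gamma ?k / ?c powr ?k))"
    using assms(1) by (intro ennreal_mult'[symmetric]) simp
  finally show ?thesis .
qed

section \<open>The normalizing constant of a tree\<close>

text \<open>The test vector with entries \<open>D $ j $ j\<close> at \<open>i\<close> and
  \<open>- (D $ i $ j)\<close> at \<open>j\<close> has quadratic form \<open>D $ j $ j\<close> times
  the minor.\<close>

lemma pos_def_pair:
  fixes D :: "real^'k^'k"
  assumes "pos_def D" "i \<noteq> j"
  shows "0 < D $ i $ i * D $ j $ j - (D $ i $ j)\<^sup>2"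
proof -
  let ?a = "D $ j $ j" and ?b = "- (D $ i $ j)"
  let ?y = "?a *\<^sub>R axis i 1 + ?b *\<^sub>R axis j 1 :: real^'k"
  have pos: "0 < ?a" by (rule pos_def_diag[OF assms(1)])
  have "?y $ i \<noteq> 0" using assms(2) pos by (simp add: axis_def)
  then have "?y \<noteq> 0" by (metis zero_index)
  then have "0 < ?y \<bullet> (D *v ?y)" using assms(1) unfolding pos_def_def by blast
  also have "D *v ?y = ?a *\<^sub>R column i D + ?b *\<^sub>R column j D"
    by (simp only: matrix_vector_right_distrib matrix_vector_mult_scaleR matrix_vector_mult_basis)
  also have "?y \<bullet> \<dots> = ?a * (?a * D $ i $ i + ?b * D $ i $ j) + ?b * (?a * D $ j $ i + ?b * D $ j $ j)"
    by (simp only: inner_add_left inner_scaleR_left inner_axis') (simp add: column_def)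
  also have "\<dots> = ?a * (D $ i $ i * D $ j $ j - (D $ i $ j)\<^sup>2)"
    using pos_def_sym[OF assms(1), of j i] by (simp add: power2_eq_square algebra_simps)
  finally show ?thesis using pos by (simp add: zero_less_mult_iff)
qed

text \<open>Builds the tree from the root by attaching leaves: as \<open>S\<close> is closed under
  \<open>f\<close>, the new vertex \<open>v\<close> is the parent of no vertex of \<open>S\<close>.
  A largest reachable set is everything, since a vertex of least level outside it would have its
  parent inside.\<close>

lemma rooted_set_induct [consumes 1, case_names root grow]:
  fixes r :: "'k::finite"
  assumes f: "parent_map r f"
    and root: "P {r}"
    and grow: "\<And>S v. r \<in> S \<Longrightarrow> f ` S \<subseteq> S \<Longrightarrow> v \<notin> S \<Longrightarrow> f v \<in> S \<Longrightarrow> P S \<Longrightarrow> P (insert v S)"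
  shows "P UNIV"
proof -
  from f obtain l :: "'k \<Rightarrow> nat" where l: "\<And>v. v \<noteq> r \<Longrightarrow> l (f v) < l v" and r: "f r = r"
    unfolding parent_map_def by blast
  let ?good = "\<lambda>S. r \<in> S \<and> f ` S \<subseteq> S \<and> P S"
  have "?good {r}" using root r by auto
  then obtain S where S: "?good S" and max: "\<And>T. ?good T \<Longrightarrow> card T \<le> card S"
    using ex_has_greatest_nat[of ?good "{r}" card "Suc CARD('k)"]
    by (metis card_mono finite_class.finite_UNIV le_imp_less_Suc subset_UNIV)
  have "S = UNIV"
  proof (rule ccontr)
    assume "S \<noteq> UNIV"
    then obtain v0 where "v0 \<notin> S" by auto
    then obtain v where v: "v \<notin> S" and min: "\<And>y. y \<notin> S \<Longrightarrow> l v \<le> l y"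
      using ex_has_least_nat[of "\<lambda>v. v \<notin> S" v0 l] by auto
    have "v \<noteq> r" using v S by auto
    then have "f v \<in> S" using min[of "f v"] l[of v] by force
    then have "?good (insert v S)" using S v grow[of S v] by auto
    from max[OF this] v show False by simp
  qed
  with S show ?thesis by simp
qed

text \<open>
  The partially assembled model on a set \<open>S\<close> of vertices containing the root and closed under
  \<open>f\<close>; the vertices outside \<open>S\<close> contribute an identity block.
\<close>

definition tree_entries :: "'k \<Rightarrow> ('k \<Rightarrow> 'k) \<Rightarrow> 'k set \<Rightarrow> 'k set set" where
  "tree_entries r f S = (\<lambda>v. {v}) ` S \<union> (\<lambda>v. {v, f v}) ` (S - {r})"

definition tree_matrix :: "'k \<Rightarrow> ('k \<Rightarrow> 'k) \<Rightarrow> 'k set \<Rightarrow> ('k set \<Rightarrow> real) \<Rightarrow> real^'k^'k" where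
  "tree_matrix r f S \<theta> =
     (\<chi> i j. if {i, j} \<in> tree_entries r f S then \<theta> {i, j} else if i = j then 1 else 0)"

text \<open>This is the trace of the product with \<open>D\<close>, restricted to \<open>S\<close>;
  the factor 2 accounts for the two symmetric positions of each edge.\<close>

definition tree_trace :: "'k \<Rightarrow> ('k \<Rightarrow> 'k) \<Rightarrow> real^'k^'k \<Rightarrow> 'k set \<Rightarrow> ('k set \<Rightarrow> real) \<Rightarrow> real" where
  "tree_trace r f D S \<theta> =
     (\<Sum>v\<in>S. \<theta> {v} * D $ v $ v) + 2 * (\<Sum>v\<in>S - {r}. \<theta> {v, f v} * D $ v $ f v)"

definition tree_kernel ::
    "real \<Rightarrow> real^'k^'k \<Rightarrow> 'k \<Rightarrow> ('k \<Rightarrow> 'k) \<Rightarrow> 'k set \<Rightarrow> ('k set \<Rightarrow> real) \<Rightarrow> real" where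
  "tree_kernel \<delta> D r f S \<theta> =
     (if pos_def (tree_matrix r f S \<theta>)
      then det (tree_matrix r f S \<theta>) powr (\<delta> / 2 - 1) * exp (- tree_trace r f D S \<theta> / 2) else 0)"

lemma tree_kernel_cong:
  assumes "\<And>e. e \<in> tree_entries r f S \<Longrightarrow> \<theta> e = \<eta> e"
  shows "tree_kernel \<delta> D r f S \<theta> = tree_kernel \<delta> D r f S \<eta>"
proof -
  have "tree_matrix r f S \<theta> = tree_matrix r f S \<eta>"
    using assms by (simp add: tree_matrix_def vec_eq_iff)
  moreover have "tree_trace r f D S \<theta> = tree_trace r f D S \<eta>"
    using assms by (simp add: tree_trace_def tree_entries_def)
  ultimately show ?thesis by (simp add: tree_kernel_def)
qed

lemma tree_kernel_nonneg: "0 \<le> tree_kernel \<delta> D r f S \<theta>"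
  by (simp add: tree_kernel_def)

lemma tree_kernel_root:
  "tree_kernel \<delta> D r f {r} \<theta> =
    (if \<theta> {r} > 0 then \<theta> {r} powr (\<delta> / 2 - 1) * exp (- (\<theta> {r} * D $ r $ r) / 2) else 0)"
proof -
  let ?M = "tree_matrix r f {r} \<theta>"
  have M: "?M $ i $ j = (if i = r \<and> j = r then \<theta> {r} else if i = j then 1 else 0)" for i j
    by (auto simp: tree_matrix_def tree_entries_def)
  show ?thesis
  proof (cases "\<theta> {r} > 0")
    case True
    \<comment> \<open>A pivoting step with nothing but an identity block left over.\<close>
    note bordered = pos_def_bordered[of "mat 1" r ?M "\<lambda>i. if i = r then sqrt (\<theta> {r}) else 0"]
    have "det ?M = \<theta> {r}" "pos_def ?M"
      using bordered True by (auto simp: M mat_def pos_def_mat1[unfolded mat_def] det_I[unfolded mat_def])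
    with True show ?thesis by (simp add: tree_kernel_def tree_trace_def)
  next
    case False
    then have "\<not> pos_def ?M" using pos_def_diag[of ?M r] by (auto simp: M)
    with False show ?thesis by (simp add: tree_kernel_def)
  qed
qed

lemma tree_entries_insert:
  assumes "v \<noteq> r"
  shows "tree_entries r f (insert v S) = insert {v} (insert {v, f v} (tree_entries r f S))"
  using assms by (auto simp: tree_entries_def)

lemma tree_entries_subset:
  assumes "f ` S \<subseteq> S" "e \<in> tree_entries r f S"
  shows "e \<subseteq> S"
  using assms by (auto simp: tree_entries_def)

text \<open>Pivoting on the leaf \<open>v\<close> changes the remaining matrix only in the diagonal entry of its parent.\<close>

lemma tree_kernel_insert:
  fixes D :: "real^'k^'k"
  assumes f: "parent_map r f" and r: "r \<in> S" and closed: "f ` S \<subseteq> S" and v: "v \<notin> S" and u: "f v \<in> S"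
  shows "tree_kernel \<delta> D r f (insert v S) \<theta> =
    (if \<theta> {v} > 0 then \<theta> {v} powr (\<delta> / 2 - 1) *
       exp (- (\<theta> {v} * D $ v $ v + 2 * \<theta> {v, f v} * D $ v $ f v +
         (\<theta> {v, f v})\<^sup>2 / \<theta> {v} * D $ f v $ f v) / 2) else 0) *
    tree_kernel \<delta> D r f S (\<theta>({f v} := \<theta> {f v} + - ((\<theta> {v, f v})\<^sup>2 / \<theta> {v})))"
proof -
  define a where "a = \<theta> {v}"
  define b where "b = \<theta> {v, f v}"
  define \<theta>' where "\<theta>' = \<theta>({f v} := \<theta> {f v} + - (b\<^sup>2 / a))"
  let ?M = "tree_matrix r f (insert v S) \<theta>" and ?A = "tree_matrix r f S \<theta>'"
  have vr: "v \<noteq> r" using r v by auto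
  have vu: "v \<noteq> f v" using u v by auto
  note sub = tree_entries_subset[OF closed, where r = r]
  have out: "{v, x} \<notin> tree_entries r f S" "{x, v} \<notin> tree_entries r f S" for x
    using sub v by auto
  have M: "?M $ i $ j = (if {i, j} = {v} then a else if {i, j} = {v, f v} then b
      else if {i, j} \<in> tree_entries r f S then \<theta> {i, j} else if i = j then 1 else 0)" for i j
    unfolding tree_matrix_def tree_entries_insert[OF vr] by (auto simp: a_def b_def)
  have A: "?A $ i $ j = (if {i, j} = {f v} then \<theta> {f v} - b\<^sup>2 / a
      else if {i, j} \<in> tree_entries r f S then \<theta> {i, j} else if i = j then 1 else 0)" for i j
    using u by (auto simp: tree_matrix_def \<theta>'_def tree_entries_def)
  have uin: "{f v} \<in> tree_entries r f S" using u by (auto simp: tree_entries_def)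
  show ?thesis
  proof (cases "a > 0")
    case True
    \<comment> \<open>The rank-one term that reproduces row and column \<open>v\<close> of the
      matrix; it also puts \<open>b\<^sup>2 / a\<close> at the diagonal entry of \<open>f v\<close>,
      which the shift in \<open>\<theta>'\<close> compensates.\<close>
    define q where "q i = (if i = v then sqrt a else if i = f v then b / sqrt a else 0)" for i
    have sq: "b / sqrt a * (b / sqrt a) = b\<^sup>2 / a" "sqrt a * sqrt a = a" "sqrt a \<noteq> 0"
      using True by (simp_all add: power2_eq_square)
    have MA: "?M $ i $ j = (if i = v \<or> j = v then 0 else ?A $ i $ j) + q i * q j" for i j
    proof -
      consider "i = v" "j = v" | "i = v" "j = f v" | "i = v" "j \<noteq> v" "j \<noteq> f v"
        | "j = v" "i = f v" | "j = v" "i \<noteq> v" "i \<noteq> f v"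
        | "i = f v" "j = f v" | "i \<noteq> v" "j \<noteq> v" "\<not> (i = f v \<and> j = f v)"
        by blast
      then show ?thesis
        by cases (use vu out sq uin in \<open>simp_all add: M A q_def doubleton_eq_iff insert_commute\<close>)
    qed
    have Av: "?A $ v $ j = (if j = v then 1 else 0)" "?A $ j $ v = (if j = v then 1 else 0)" for j
      using vu out by (auto simp: A doubleton_eq_iff)
    have "q v > 0" using True by (simp add: q_def)
    note bordered = pos_def_bordered[OF Av MA this]
    have det: "det ?M = a * det ?A" using bordered(1) True by (simp add: q_def)
    have trace: "tree_trace r f D (insert v S) \<theta> =
        (a * D $ v $ v + 2 * b * D $ v $ f v + b\<^sup>2 / a * D $ f v $ f v) + tree_trace r f D S \<theta>'"
    proof -
      have "(\<Sum>w\<in>S. \<theta> {w} * D $ w $ w) = (\<Sum>w\<in>S. \<theta>' {w} * D $ w $ w) + b\<^sup>2 / a * D $ f v $ f v"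
      proof -
        have "(\<Sum>w\<in>S. \<theta> {w} * D $ w $ w) =
            (\<Sum>w\<in>S. \<theta>' {w} * D $ w $ w + (if w = f v then b\<^sup>2 / a * D $ f v $ f v else 0))"
          by (rule sum.cong) (auto simp: \<theta>'_def algebra_simps)
        then show ?thesis using u by (simp add: sum.distrib)
      qed
      moreover have "(\<Sum>w\<in>S - {r}. \<theta>' {w, f w} * D $ w $ f w) = (\<Sum>w\<in>S - {r}. \<theta> {w, f w} * D $ w $ f w)"
        using parent_map_fixed_iff[OF f] by (intro sum.cong) (auto simp: \<theta>'_def)
      moreover have "insert v S - {r} = insert v (S - {r})" using vr by auto
      ultimately show ?thesis
        using v by (simp add: tree_trace_def a_def b_def algebra_simps)
    qed
    show ?thesis
    proof (cases "pos_def ?A")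
      case pd: True
      have "det ?M powr (\<delta> / 2 - 1) = a powr (\<delta> / 2 - 1) * det ?A powr (\<delta> / 2 - 1)"
        unfolding det by (rule powr_mult)
      moreover have "exp (- tree_trace r f D (insert v S) \<theta> / 2) =
        exp (- (a * D $ v $ v + 2 * b * D $ v $ f v + b\<^sup>2 / a * D $ f v $ f v) / 2) *
        exp (- tree_trace r f D S \<theta>' / 2)"
        unfolding trace by (simp add: exp_add[symmetric] add_divide_distrib diff_divide_distrib)
      ultimately show ?thesis
        using pd True bordered(2)
        unfolding a_def[symmetric] b_def[symmetric] \<theta>'_def[symmetric] tree_kernel_def by simp
    next
      case False
      then show ?thesis
        using bordered(2)
        unfolding a_def[symmetric] b_def[symmetric] \<theta>'_def[symmetric] tree_kernel_def by simp
    qed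
  next
    case False
    then have "\<not> pos_def ?M" using pos_def_diag[of ?M v] by (auto simp: M)
    with False show ?thesis by (simp add: tree_kernel_def a_def)
  qed
qed

text \<open>The value of \<open>nn_integral_edge\<close> for child \<open>v\<close> and parent
  \<open>u\<close>, with the three matching entries of \<open>D\<close> as coefficients.\<close>

definition edge_integral :: "real \<Rightarrow> real^'k^'k \<Rightarrow> 'k \<Rightarrow> 'k \<Rightarrow> real" where
  "edge_integral \<delta> D v u = sqrt (2 * pi / D $ u $ u) * (Gamma ((\<delta> + 1) / 2) /
     ((D $ v $ v * D $ u $ u - (D $ v $ u)\<^sup>2) / (2 * D $ u $ u)) powr ((\<delta> + 1) / 2))"

text \<open>By induction over attached leaves: each leaf contributes one
  \<open>edge_integral\<close>, the root a Gamma integral. Measurability is carried along because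
  the next Fubini step requires it.\<close>

lemma tree_kernel_integral:
  fixes D :: "real^'k^'k"
  assumes f: "parent_map r f" and D: "pos_def D" and \<delta>: "\<delta> > 0"
  shows "tree_kernel \<delta> D r f UNIV \<in> borel_measurable (\<Pi>\<^sub>M e\<in>tree_entries r f UNIV. lborel) \<and>
    (\<integral>\<^sup>+\<theta>. ennreal (tree_kernel \<delta> D r f UNIV \<theta>) \<partial>(\<Pi>\<^sub>M e\<in>tree_entries r f UNIV. lborel)) =
    ennreal (Gamma (\<delta> / 2) / (D $ r $ r / 2) powr (\<delta> / 2) * (\<Prod>v\<in>UNIV - {r}. edge_integral \<delta> D v (f v)))"
  using f
proof (induction rule: rooted_set_induct)
  case root
  interpret product_sigma_finite "\<lambda>_::'k set. lborel :: real measure" by unfold_locales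
  have E: "tree_entries r f {r} = {{r}}" by (auto simp: tree_entries_def)
  have meas: "tree_kernel \<delta> D r f {r} \<in> borel_measurable (\<Pi>\<^sub>M e\<in>{{r}}. lborel)"
    unfolding tree_kernel_root by measurable
  have "(\<integral>\<^sup>+\<theta>. ennreal (tree_kernel \<delta> D r f {r} \<theta>) \<partial>(\<Pi>\<^sub>M e\<in>{{r}}. lborel)) =
      (\<integral>\<^sup>+a. ennreal (if a > 0 then a powr (\<delta> / 2 - 1) * exp (- (D $ r $ r / 2) * a) else 0) \<partial>lborel)"
    unfolding tree_kernel_root
    by (subst product_nn_integral_singleton) (auto simp: mult.commute intro!: nn_integral_cong)
  also have "\<dots> = ennreal (Gamma (\<delta> / 2) / (D $ r $ r / 2) powr (\<delta> / 2))"
    by (rule nn_integral_gamma) (use pos_def_diag[OF D] \<delta> in auto)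
  finally show ?case using meas by (simp add: E)
next
  case (grow S v)
  interpret product_sigma_finite "\<lambda>_::'k set. lborel :: real measure" by unfold_locales
  let ?P = "\<lambda>E. (\<Pi>\<^sub>M e\<in>E. lborel :: real measure)"
  let ?E = "tree_entries r f S" and ?K = "tree_kernel \<delta> D r f S" and ?u = "f v"
  let ?E1 = "insert {v, ?u} ?E" and ?K' = "tree_kernel \<delta> D r f (insert v S)"
  define h where "h a b = (if a > 0 then a powr (\<delta> / 2 - 1) *
       exp (- (a * D $ v $ v + 2 * b * D $ v $ ?u + b\<^sup>2 / a * D $ ?u $ ?u) / 2) else 0)" for a b :: real
  note kernel = tree_kernel_insert[OF f grow(1-4), of \<delta> D, folded h_def]
  have vr: "v \<noteq> r" and vu: "v \<noteq> ?u" using grow(1,3,4) by auto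
  have E': "tree_entries r f (insert v S) = insert {v} ?E1" by (rule tree_entries_insert[OF vr])
  have fin: "finite ?E" "finite ?E1" by auto
  have out: "{v} \<notin> ?E1" "{v, ?u} \<notin> ?E"
    using tree_entries_subset[OF grow(2), where r = r] grow(3) vu by auto
  have uE: "{?u} \<in> ?E" using grow(4) by (auto simp: tree_entries_def)
  have K[measurable]: "?K \<in> borel_measurable (?P ?E)" using grow by simp
  have h[measurable]: "(\<lambda>x. h (a x) (b x)) \<in> borel_measurable N"
    if [measurable]: "a \<in> borel_measurable N" "b \<in> borel_measurable N" for a b and N :: "'z measure"
    unfolding h_def by measurable
  have hnn: "0 \<le> h a b" for a b by (simp add: h_def)
  have K'[measurable]: "?K' \<in> borel_measurable (?P (insert {v} ?E1))"
  proof -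
    \<comment> \<open>The restriction makes the shifted point land in the product space over
      \<open>?E\<close>; by \<open>tree_kernel_cong\<close> it leaves the kernel unchanged.\<close>
    define T where "T \<theta> = restrict (\<theta>({?u} := \<theta> {?u} + - ((\<theta> {v, ?u})\<^sup>2 / \<theta> {v}))) ?E" for \<theta> :: "'k set \<Rightarrow> real"
    have T: "T \<in> measurable (?P (insert {v} ?E1)) (?P ?E)"
      unfolding T_def
    proof (rule measurable_restrict)
      fix e assume "e \<in> ?E"
      then show "(\<lambda>\<theta>. (\<theta>({?u} := \<theta> {?u} + - ((\<theta> {v, ?u})\<^sup>2 / \<theta> {v}))) e) \<in> measurable (?P (insert {v} ?E1)) lborel"
        using uE by (cases "e = {?u}") auto
    qed
    have "?K (\<theta>({?u} := \<theta> {?u} + - ((\<theta> {v, ?u})\<^sup>2 / \<theta> {v}))) = ?K (T \<theta>)" for \<theta>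
      by (rule tree_kernel_cong) (simp add: T_def)
    then have "?K' \<theta> = h (\<theta> {v}) (\<theta> {v, ?u}) * ?K (T \<theta>)" for \<theta>
      unfolding kernel by simp
    then have "?K' = (\<lambda>\<theta>. h (\<theta> {v}) (\<theta> {v, ?u}) * ?K (T \<theta>))" by blast
    also have "\<dots> \<in> borel_measurable (?P (insert {v} ?E1))"
      using measurable_compose[OF T K] by (intro borel_measurable_times h) auto
    finally show ?thesis .
  qed
  have K'a: "(\<lambda>\<theta>. ?K' (\<theta>({v} := a))) \<in> borel_measurable (?P ?E1)" for a
    by (rule measurable_compose[OF _ K'], rule measurable_fun_upd[where J = ?E1]) auto
  have "(\<integral>\<^sup>+\<theta>. ennreal (?K' \<theta>) \<partial>?P (insert {v} ?E1)) =
      (\<integral>\<^sup>+a. (\<integral>\<^sup>+\<theta>. ennreal (?K' (\<theta>({v} := a))) \<partial>?P ?E1) \<partial>lborel)"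
    by (rule product_nn_integral_insert_rev[OF fin(2) out(1)]) measurable
  also have "\<dots> = (\<integral>\<^sup>+a. (\<integral>\<^sup>+b. (\<integral>\<^sup>+\<theta>. ennreal (?K' (\<theta>({v, ?u} := b, {v} := a))) \<partial>?P ?E) \<partial>lborel) \<partial>lborel)"
    by (intro nn_integral_cong product_nn_integral_insert_rev[OF fin(1) out(2)])
      (use K'a in measurable)
  also have "\<dots> = (\<integral>\<^sup>+a. (\<integral>\<^sup>+b. ennreal (h a b) * (\<integral>\<^sup>+\<theta>. ennreal (?K \<theta>) \<partial>?P ?E) \<partial>lborel) \<partial>lborel)"
  \<comment> \<open>With \<open>a\<close> and \<open>b\<close> fixed the pivot shift is a constant,
    so translation invariance removes it and the integral over the remaining entries no longer
    depends on \<open>a\<close> and \<open>b\<close>.\<close>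
  proof (intro nn_integral_cong)
    fix a b :: real
    let ?t = "- (b\<^sup>2 / a)"
    have eq: "?K' (\<theta>({v, ?u} := b, {v} := a)) = h a b * ?K (\<theta>({?u} := \<theta> {?u} + ?t))" for \<theta>
    proof -
      have "?K' (\<theta>({v, ?u} := b, {v} := a)) =
          h a b * ?K (\<theta>({v, ?u} := b, {v} := a, {?u} := \<theta> {?u} + ?t))"
        unfolding kernel using vu by (simp add: doubleton_eq_iff)
      also have "?K (\<theta>({v, ?u} := b, {v} := a, {?u} := \<theta> {?u} + ?t)) = ?K (\<theta>({?u} := \<theta> {?u} + ?t))"
        by (rule tree_kernel_cong) (use out in auto)
      finally show ?thesis .
    qed
    have shift: "(\<lambda>\<theta>. \<theta>({?u} := \<theta> {?u} + ?t)) \<in> measurable (?P ?E) (?P ?E)"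
      by (rule measurable_fun_upd[where J = ?E]) (use uE in auto)
    have "(\<integral>\<^sup>+\<theta>. ennreal (?K' (\<theta>({v, ?u} := b, {v} := a))) \<partial>?P ?E) =
        ennreal (h a b) * (\<integral>\<^sup>+\<theta>. ennreal (?K (\<theta>({?u} := \<theta> {?u} + ?t))) \<partial>?P ?E)"
      unfolding eq ennreal_mult'[OF hnn]
      by (rule nn_integral_cmult) (use measurable_compose[OF shift K] in measurable)
    also have "(\<integral>\<^sup>+\<theta>. ennreal (?K (\<theta>({?u} := \<theta> {?u} + ?t))) \<partial>?P ?E) = (\<integral>\<^sup>+\<theta>. ennreal (?K \<theta>) \<partial>?P ?E)"
      by (rule nn_integral_PiM_translate[OF fin(1) uE]) measurable
    finally show "(\<integral>\<^sup>+\<theta>. ennreal (?K' (\<theta>({v, ?u} := b, {v} := a))) \<partial>?P ?E) =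
      ennreal (h a b) * (\<integral>\<^sup>+\<theta>. ennreal (?K \<theta>) \<partial>?P ?E)" .
  qed
  also have "\<dots> = (\<integral>\<^sup>+a. (\<integral>\<^sup>+b. ennreal (h a b) \<partial>lborel) \<partial>lborel) * (\<integral>\<^sup>+\<theta>. ennreal (?K \<theta>) \<partial>?P ?E)"
    by (simp add: nn_integral_multc)
  also have "(\<integral>\<^sup>+a. (\<integral>\<^sup>+b. ennreal (h a b) \<partial>lborel) \<partial>lborel) = ennreal (edge_integral \<delta> D v ?u)"
    unfolding h_def edge_integral_def
    by (rule nn_integral_edge) (use pos_def_diag[OF D] pos_def_pair[OF D vu] \<delta> in auto)
  also have "(\<integral>\<^sup>+\<theta>. ennreal (?K \<theta>) \<partial>?P ?E) =
      ennreal (Gamma (\<delta> / 2) / (D $ r $ r / 2) powr (\<delta> / 2) * (\<Prod>v\<in>S - {r}. edge_integral \<delta> D v (f v)))"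
    using grow by simp
  also have "ennreal (edge_integral \<delta> D v ?u) * \<dots> =
      ennreal (Gamma (\<delta> / 2) / (D $ r $ r / 2) powr (\<delta> / 2) * (\<Prod>v\<in>insert v S - {r}. edge_integral \<delta> D v (f v)))"
  proof -
    have "0 \<le> edge_integral \<delta> D v ?u"
      using pos_def_diag[OF D, of ?u] \<delta> unfolding edge_integral_def
      by (intro mult_nonneg_nonneg divide_nonneg_nonneg) (auto intro!: Gamma_real_nonneg)
    moreover have "insert v S - {r} = insert v (S - {r})" using vr by auto
    ultimately show ?thesis
      using grow(3) by (simp add: ennreal_mult'[symmetric] mult_ac)
  qed
  finally show ?case using K' unfolding E' by simp
qed

text \<open>Every matrix on the segment from the identity to \<open>A\<close> has a positive
  quadratic form and is therefore invertible, so the determinant, equal to 1 at the identity, cannot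
  reach zero.\<close>

lemma pos_def_det_pos:
  fixes A :: "real^'k^'k"
  assumes "pos_def A"
  shows "0 < det A"
proof (rule ccontr)
  let ?B = "\<lambda>t::real. (1 - t) *\<^sub>R mat 1 + t *\<^sub>R A"
  assume "\<not> 0 < det A"
  moreover have "continuous_on {0..1} (\<lambda>t. det (?B t))"
    unfolding det_def by (intro continuous_intros)
  ultimately obtain t where t: "0 \<le> t" "t \<le> 1" "det (?B t) = 0"
    using IVT2'[of "\<lambda>t. det (?B t)" 1 0 0] by auto
  have "0 < y \<bullet> (?B t *v y)" if "y \<noteq> 0" for y
  proof -
    have "y \<bullet> (?B t *v y) = (1 - t) * (y \<bullet> y) + t * (y \<bullet> (A *v y))"
      by (simp add: matrix_vector_mult_add_rdistrib scaleR_matrix_vector_assoc[symmetric] inner_add_right)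
    moreover have "0 < y \<bullet> y" "0 < y \<bullet> (A *v y)"
      using that assms by (auto simp: pos_def_def)
    ultimately show ?thesis
      using t(1,2) by (cases "t = 0") (auto intro: add_nonneg_pos)
  qed
  then have "?B t *v y \<noteq> 0" if "y \<noteq> 0" for y
    using that by (metis inner_zero_right less_irrefl)
  then have "invertible (?B t)"
    unfolding invertible_left_inverse matrix_left_invertible_ker by blast
  with t(3) show False by (simp add: invertible_det_nz)
qed

section \<open>From the tree kernel to the Hyper-Wishart kernel\<close>

lemma free_entries_edges_of: "free_entries (edges_of r f) = tree_entries r f UNIV"
  by (simp add: free_entries_def edges_of_def tree_entries_def)

lemma matrix_of_entries_edges_of: "matrix_of_entries (edges_of r f) \<theta> = tree_matrix r f UNIV \<theta>"
  unfolding matrix_of_entries_def free_entries_edges_of tree_matrix_def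
  by (auto simp: vec_eq_iff tree_entries_def)

text \<open>Ensures that no edge is claimed by both of its ends, so that edge sums over child
  vertices count each edge once.\<close>

lemma parent_map_no_swap:
  assumes "parent_map r f" "v \<noteq> r"
  shows "f (f v) \<noteq> v"
proof -
  obtain l :: "'a \<Rightarrow> nat" where l: "\<And>v. v \<noteq> r \<Longrightarrow> l (f v) < l v" and r: "f r = r"
    using assms unfolding parent_map_def by blast
  show ?thesis using l[OF assms(2)] l[of "f v"] r assms(2) by (cases "f v = r") auto
qed

lemma trace_tree_matrix:
  fixes D :: "real^'k^'k"
  assumes f: "parent_map r f" and D: "pos_def D"
  shows "trace (tree_matrix r f UNIV \<theta> ** D) = tree_trace r f D UNIV \<theta>"
proof -
  \<comment> \<open>Zero at the root, where \<open>f r = r\<close> would count the diagonal entry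
    again.\<close>
  let ?c = "\<lambda>v. if v = r then 0 else \<theta> {v, f v}"
  have M: "tree_matrix r f UNIV \<theta> $ i $ j * D $ j $ i =
      (if j = i then \<theta> {i} * D $ i $ i else 0) + (if j = f i then ?c i * D $ i $ f i else 0) +
      (if i = f j then ?c j * D $ j $ f j else 0)" for i j
  proof -
    have "{i, j} \<in> tree_entries r f UNIV \<longleftrightarrow> i = j \<or> i \<noteq> r \<and> f i = j \<or> j \<noteq> r \<and> f j = i"
      by (auto simp: tree_entries_def doubleton_eq_iff)
    then show ?thesis
      using parent_map_fixed_iff[OF f, of i] parent_map_fixed_iff[OF f, of j]
        parent_map_no_swap[OF f, of i] pos_def_sym[OF D, of i j]
      by (cases "i = j"; cases "f i = j"; cases "f j = i"; cases "i = r"; cases "j = r")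
        (auto simp: tree_matrix_def insert_commute)
  qed
  have "trace (tree_matrix r f UNIV \<theta> ** D) =
      (\<Sum>i\<in>UNIV. \<theta> {i} * D $ i $ i) + (\<Sum>i\<in>UNIV. ?c i * D $ i $ f i) +
      (\<Sum>i\<in>UNIV. \<Sum>j\<in>UNIV. if i = f j then ?c j * D $ j $ f j else 0)"
    by (simp add: trace_def matrix_matrix_mult_def M sum.distrib)
  also have "(\<Sum>i\<in>UNIV. \<Sum>j\<in>UNIV. if i = f j then ?c j * D $ j $ f j else 0) =
      (\<Sum>j\<in>UNIV. ?c j * D $ j $ f j)"
    by (subst sum.swap) simp
  also have "(\<Sum>i\<in>UNIV. ?c i * D $ i $ f i) = (\<Sum>i\<in>UNIV - {r}. \<theta> {i, f i} * D $ i $ f i)"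
    by (simp add: sum.remove[of _ r])
  finally show ?thesis by (simp add: tree_trace_def)
qed

definition tree_normalizer :: "real \<Rightarrow> real^'k^'k \<Rightarrow> 'k \<Rightarrow> ('k \<Rightarrow> 'k) \<Rightarrow> real" where
  "tree_normalizer \<delta> D r f =
     Gamma (\<delta> / 2) / (D $ r $ r / 2) powr (\<delta> / 2) * (\<Prod>v\<in>UNIV - {r}. edge_integral \<delta> D v (f v))"

lemma g_factor_pos:
  assumes "\<delta> > 0" "pos_def D" "v \<noteq> u"
  shows "g_factor \<delta> D v u > 0"
  using assms pos_def_diag[OF assms(2)] pos_def_pair[OF assms(2,3)] pos_def_sym[OF assms(2), of v u]
  unfolding g_factor_def principal_minor_pair[OF assms(3)]
  by (auto intro!: divide_pos_pos mult_pos_pos Gamma_real_pos simp: power2_eq_square less_imp_neq[symmetric])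

text \<open>The factor besides \<open>g_factor\<close> depends on the child \<open>v\<close> alone.
  Every vertex except the root is a child exactly once, so the product of these factors is the same
  for all trees.\<close>

lemma edge_integral_eq_g_factor:
  assumes "\<delta> > 0" "pos_def D" "v \<noteq> u"
  shows "edge_integral \<delta> D v u =
    sqrt (2 * pi) * 2 powr ((\<delta> + 1) / 2) * Gamma (\<delta> / 2) / D $ v $ v powr (\<delta> / 2) * g_factor \<delta> D v u"
proof -
  let ?k = "(\<delta> + 1) / 2" and ?m = "D $ v $ v * D $ u $ u - (D $ v $ u)\<^sup>2"
  have pos: "0 < D $ v $ v" "0 < D $ u $ u" "0 < ?m" "0 < Gamma (\<delta> / 2)"
    using pos_def_diag[OF assms(2)] pos_def_pair[OF assms(2,3)] assms(1) by auto
  have m: "principal_minor D {v, u} = ?m"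
    using pos_def_sym[OF assms(2), of v u]
    by (simp add: principal_minor_pair[OF assms(3)] power2_eq_square)
  \<comment> \<open>The Gaussian factor \<open>1 / sqrt (D $ u $ u)\<close> lowers this power to the
    exponent \<open>\<delta> / 2\<close> found in \<open>g_factor\<close>.\<close>
  have "D $ u $ u powr ?k = D $ u $ u powr (\<delta> / 2) * sqrt (D $ u $ u)"
    using pos by (simp add: powr_half_sqrt[symmetric] powr_add[symmetric] add_divide_distrib)
  then show ?thesis
    using pos unfolding edge_integral_def g_factor_def m
    by (simp add: powr_divide powr_mult real_sqrt_divide field_simps)
qed

lemma tree_normalizer_pos:
  fixes D :: "real^'k^'k"
  assumes "parent_map r f" "\<delta> > 0" "pos_def D"
  shows "tree_normalizer \<delta> D r f > 0"
proof -
  have "0 < edge_integral \<delta> D v (f v)" if "v \<noteq> r" for v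
  proof -
    have "v \<noteq> f v" using parent_map_fixed_iff[OF assms(1), of v] that by auto
    then show ?thesis
      using assms(2) pos_def_diag[OF assms(3), of v] g_factor_pos[OF assms(2,3)]
      by (simp add: edge_integral_eq_g_factor[OF assms(2,3)] divide_pos_pos)
  qed
  then show ?thesis
    using assms(2) pos_def_diag[OF assms(3), of r] unfolding tree_normalizer_def
    by (intro mult_pos_pos prod_pos divide_pos_pos) auto
qed

text \<open>Positivity of the normalizer makes the passage from the extended nonnegative integral to
  the real one exact.\<close>

lemma hyper_wishart_integral:
  fixes D :: "real^'k^'k"
  assumes f: "parent_map r f" and "\<delta> > 0" "pos_def D"
  shows "(LINT \<theta>|entries_lebesgue (edges_of r f).
    hyper_wishart_kernel \<delta> D (matrix_of_entries (edges_of r f) \<theta>)) = tree_normalizer \<delta> D r f"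
proof -
  have kernel: "hyper_wishart_kernel \<delta> D (matrix_of_entries (edges_of r f) \<theta>) = tree_kernel \<delta> D r f UNIV \<theta>" for \<theta>
    by (simp add: matrix_of_entries_edges_of hyper_wishart_kernel_def tree_kernel_def trace_tree_matrix[OF assms(1,3)])
  note int = tree_kernel_integral[OF f assms(3,2)]
  show ?thesis
    unfolding kernel entries_lebesgue_def free_entries_edges_of
    using int tree_normalizer_pos[OF assms]
    by (subst integral_eq_nn_integral) (simp_all add: tree_kernel_nonneg tree_normalizer_def)
qed

section \<open>Conjugacy with the Gaussian likelihood\<close>

lemma trace_gram:
  fixes x :: "real^'k^'n" and \<Delta> :: "real^'k^'k"
  shows "trace (\<Delta> ** (transpose x ** x)) = (\<Sum>a\<in>UNIV. row a x \<bullet> (\<Delta> *v row a x))"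
proof -
  have "trace (\<Delta> ** (transpose x ** x)) =
      (\<Sum>i\<in>UNIV. \<Sum>j\<in>UNIV. \<Sum>a\<in>UNIV. x $ a $ i * (\<Delta> $ i $ j * x $ a $ j))"
    by (simp add: trace_def matrix_matrix_mult_def transpose_def sum_distrib_left mult_ac)
  also have "\<dots> = (\<Sum>i\<in>UNIV. \<Sum>a\<in>UNIV. \<Sum>j\<in>UNIV. x $ a $ i * (\<Delta> $ i $ j * x $ a $ j))"
    by (intro sum.cong refl sum.swap)
  also have "\<dots> = (\<Sum>a\<in>UNIV. \<Sum>i\<in>UNIV. \<Sum>j\<in>UNIV. x $ a $ i * (\<Delta> $ i $ j * x $ a $ j))"
    by (rule sum.swap)
  finally show ?thesis
    by (simp add: inner_vec_def matrix_vector_mult_def row_def sum_distrib_left)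
qed

lemma pos_def_add_gram:
  fixes x :: "real^'k^'n"
  assumes "pos_def D"
  shows "pos_def (D + transpose x ** x)"
proof -
  have "transpose (D + transpose x ** x) = D + transpose x ** x"
    using pos_def_sym[OF assms]
    by (simp add: vec_eq_iff transpose_def matrix_matrix_mult_def mult.commute)
  moreover have "0 \<le> y \<bullet> ((transpose x ** x) *v y)" for y
    by (simp add: matrix_vector_mul_assoc[symmetric] inner_commute[of y] dot_lmul_matrix)
  ultimately show ?thesis
    using assms unfolding pos_def_def
    by (auto simp: matrix_vector_mult_add_rdistrib inner_add_right intro: add_pos_nonneg)
qed

text \<open>Each observation adds one half to the exponent of the determinant, and the quadratic
  forms of the rows add up to a trace against the Gram matrix. Off the positive definite cone both
  sides vanish.\<close>

lemma likelihood_mult_kernel: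
  fixes x :: "real^'k^'n"
  shows "likelihood \<Delta> x * hyper_wishart_kernel \<delta> D \<Delta> =
    (1 / sqrt ((2 * pi) ^ CARD('k))) ^ CARD('n) *
    hyper_wishart_kernel (\<delta> + real CARD('n)) (D + transpose x ** x) \<Delta>"
proof (cases "pos_def \<Delta>")
  case True
  then have pos: "0 < det \<Delta>" by (rule pos_def_det_pos)
  define c where "c = 1 / sqrt ((2 * pi) ^ CARD('k))"
  have "likelihood \<Delta> x = (\<Prod>a\<in>(UNIV::'n set). c * sqrt (det \<Delta>) * exp (- (row a x \<bullet> (\<Delta> *v row a x)) / 2))"
    unfolding likelihood_def gaussian_density_def by (simp add: real_sqrt_divide c_def)
  also have "\<dots> = c ^ CARD('n) * sqrt (det \<Delta>) ^ CARD('n) * exp (- trace (\<Delta> ** (transpose x ** x)) / 2)"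
    by (simp add: prod.distrib exp_sum[symmetric] trace_gram sum_negf sum_divide_distrib power_mult_distrib)
  also have "sqrt (det \<Delta>) ^ CARD('n) = det \<Delta> powr (real CARD('n) / 2)"
    using pos by (simp add: powr_half_sqrt[symmetric] powr_power)
  finally have lik: "likelihood \<Delta> x = c ^ CARD('n) * det \<Delta> powr (real CARD('n) / 2) *
      exp (- trace (\<Delta> ** (transpose x ** x)) / 2)" .
  have det_powr: "det \<Delta> powr (real CARD('n) / 2) * det \<Delta> powr (\<delta> / 2 - 1) =
      det \<Delta> powr ((\<delta> + real CARD('n)) / 2 - 1)"
    unfolding powr_add[symmetric] by (rule arg_cong[where f = "(powr) _"]) (simp add: field_simps)
  have exp_trace: "exp (- trace (\<Delta> ** (transpose x ** x)) / 2) * exp (- trace (\<Delta> ** D) / 2) =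
      exp (- trace (\<Delta> ** (D + transpose x ** x)) / 2)"
    by (simp add: exp_add[symmetric] matrix_add_ldistrib trace_add add_divide_distrib add.commute)
  show ?thesis
    using True unfolding lik hyper_wishart_kernel_def c_def[symmetric] det_powr[symmetric] exp_trace[symmetric]
    by simp
qed (simp add: hyper_wishart_kernel_def)

lemma marginal_likelihood_tree:
  fixes D :: "real^'k^'k" and x :: "real^'k^'n"
  assumes f: "parent_map r f" and \<delta>: "\<delta> > 0" and D: "pos_def D"
  shows "marginal_likelihood \<delta> D x (edges_of r f) =
    (1 / sqrt ((2 * pi) ^ CARD('k))) ^ CARD('n) *
    tree_normalizer (\<delta> + real CARD('n)) (D + transpose x ** x) r f / tree_normalizer \<delta> D r f"
proof -
  have "\<delta> + real CARD('n) > 0" using \<delta> by simp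
  note Z = hyper_wishart_integral[OF f \<delta> D] and Z' = hyper_wishart_integral[OF f this pos_def_add_gram[OF D]]
  show ?thesis
    unfolding marginal_likelihood_def hyper_wishart_density_def Z times_divide_eq_right
      likelihood_mult_kernel
    by (simp add: Z')
qed

section \<open>Edge probabilities\<close>

text \<open>\<open>K\<close> collects the Gaussian constant, the root factors and the child factors.
  It may depend on \<open>r\<close> but not on \<open>f\<close>, and so cancels in the
  posterior.\<close>

lemma marginal_likelihood_weights:
  fixes D :: "real^'k^'k" and x :: "real^'k^'n"
  assumes \<delta>: "\<delta> > 0" and D: "pos_def D"
  obtains K where "K > 0" and "\<And>f. parent_map r f \<Longrightarrow>
    marginal_likelihood \<delta> D x (edges_of r f) = K * (\<Prod>v\<in>UNIV - {r}. weight \<delta> D x v (f v))"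
proof -
  let ?d = "\<delta> + real CARD('n)" and ?D = "D + transpose x ** x"
  have \<delta>': "?d > 0" using \<delta> by simp
  note D' = pos_def_add_gram[OF D, of x]
  define A where "A \<delta> D v = sqrt (2 * pi) * 2 powr ((\<delta> + 1) / 2) * Gamma (\<delta> / 2) / D $ v $ v powr (\<delta> / 2)"
    for \<delta> and D :: "real^'k^'k" and v
  define B where "B \<delta> D = Gamma (\<delta> / 2) / (D $ r $ r / 2) powr (\<delta> / 2)" for \<delta> and D :: "real^'k^'k"
  have pos: "A \<delta> D v > 0" "B \<delta> D > 0" if "\<delta> > 0" "pos_def D" for \<delta> v and D :: "real^'k^'k"
    using that pos_def_diag[OF that(2), of v] pos_def_diag[OF that(2), of r]
    by (auto simp: A_def B_def)
  define c where "c = (1 / sqrt ((2 * pi) ^ CARD('k))) ^ CARD('n)"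
  have "c > 0" by (simp add: c_def)
  define K where "K = c * (B ?d ?D / B \<delta> D) *
    (\<Prod>v\<in>UNIV - {r}. A ?d ?D v / A \<delta> D v)"
  have "K > 0"
    unfolding K_def by (intro mult_pos_pos prod_pos divide_pos_pos pos \<delta> \<delta>' D D' \<open>c > 0\<close>)
  moreover have "marginal_likelihood \<delta> D x (edges_of r f) = K * (\<Prod>v\<in>UNIV - {r}. weight \<delta> D x v (f v))"
    if f: "parent_map r f" for f
  proof -
    have Z: "tree_normalizer \<delta> D r f = B \<delta> D * (\<Prod>v\<in>UNIV - {r}. A \<delta> D v * g_factor \<delta> D v (f v))"
      if "\<delta> > 0" "pos_def D" for \<delta> and D :: "real^'k^'k"
      unfolding tree_normalizer_def B_def A_def
      by (intro arg_cong2[where f="(*)"] prod.cong refl edge_integral_eq_g_factor[OF that])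
        (metis DiffD2 f insertI1 parent_map_fixed_iff)
    show ?thesis
      unfolding marginal_likelihood_tree[OF f \<delta> D] Z[OF \<delta> D] Z[OF \<delta>' D'] K_def weight_def
        c_def[symmetric] prod.distrib prod_dividef
      by (simp only: times_divide_times_eq times_divide_eq_left times_divide_eq_right
        divide_divide_eq_left mult.assoc)
  qed
  ultimately show thesis by (rule that)
qed

lemma weight_pos:
  assumes "\<delta> > 0" "pos_def D" "i \<noteq> j"
  shows "weight \<delta> D x i j > 0"
  unfolding weight_def
  using assms by (intro divide_pos_pos g_factor_pos pos_def_add_gram) auto

lemma weight_commute:
  assumes "i \<noteq> j"
  shows "weight \<delta> D x i j = weight \<delta> D x j i"
proof -
  have "g_factor \<delta> D i j = g_factor \<delta> D j i" for \<delta> D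
    by (simp add: g_factor_def insert_commute mult.commute)
  then show ?thesis by (simp add: weight_def)
qed

text \<open>Rooting the trees at \<open>i\<close> turns membership of \<open>{i, j}\<close> into the
  condition \<open>f j = i\<close>, since the root has no outgoing edge; the uniform prior and
  \<open>K\<close> cancel.\<close>

lemma edge_probability_parent_maps:
  fixes D :: "real^'k^'k" and x :: "real^'k^'n"
  assumes \<delta>: "\<delta> > 0" and D: "pos_def D" and "i \<noteq> j"
  shows "edge_probability \<delta> D x i j =
    (\<Sum>f | parent_map i f \<and> f j = i. \<Prod>v\<in>UNIV - {i}. weight \<delta> D x v (f v)) /
    (\<Sum>f | parent_map i f. \<Prod>v\<in>UNIV - {i}. weight \<delta> D x v (f v))"
proof -
  let ?W = "\<lambda>f. \<Prod>v\<in>UNIV - {i}. weight \<delta> D x v (f v)"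
  obtain K where K: "K > 0" and marg: "\<And>f. parent_map i f \<Longrightarrow> marginal_likelihood \<delta> D x (edges_of i f) = K * ?W f"
    using marginal_likelihood_weights[OF \<delta> D] by metis
  define p where "p = real CARD('k) powi (2 - int CARD('k))"
  have p: "p > 0" by (simp add: p_def)
  have weighted: "tree_prior (edges_of i f) * marginal_likelihood \<delta> D x (edges_of i f) = (p * K) * ?W f"
    if "parent_map i f" for f
    using marg[OF that] by (simp add: tree_prior_def p_def)
  have total: "(\<Sum>E\<in>trees. tree_prior E * marginal_likelihood \<delta> D x E) = (p * K) * (\<Sum>f | parent_map i f. ?W f)"
    by (subst sum.reindex_bij_betw[OF edges_of_bij[of i], symmetric]) (simp add: weighted sum_distrib_left)
  have set: "{E. E \<in> trees \<and> {i, j} \<in> E} = edges_of i ` {f. parent_map i f \<and> f j = i}"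
  proof -
    have trees: "trees = edges_of i ` {f. parent_map i f}"
      using edges_of_bij[of i] by (simp add: bij_betw_def)
    then show ?thesis unfolding trees using assms(3) by (auto simp: edges_of_iff)
  qed
  have inj: "inj_on (edges_of i) {f. parent_map i f \<and> f j = i}"
    by (rule inj_on_subset[OF edges_of_inj]) auto
  have "edge_probability \<delta> D x i j =
      (\<Sum>f | parent_map i f \<and> f j = i. tree_prior (edges_of i f) * marginal_likelihood \<delta> D x (edges_of i f)) /
      ((p * K) * (\<Sum>f | parent_map i f. ?W f))"
    unfolding edge_probability_def set sum.reindex[OF inj]
    by (simp add: tree_posterior_def total sum_divide_distrib)
  also have "(\<Sum>f | parent_map i f \<and> f j = i. tree_prior (edges_of i f) * marginal_likelihood \<delta> D x (edges_of i f)) =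
      (p * K) * (\<Sum>f | parent_map i f \<and> f j = i. ?W f)"
    by (simp add: weighted sum_distrib_left)
  finally show ?thesis using p K by simp
qed

section \<open>Resistance distance and dependence on one weight\<close>

lemma weight_mult_resistance:
  fixes w :: "'k::finite \<Rightarrow> 'k \<Rightarrow> real"
  assumes "i \<noteq> j" "w i j = w j i"
  shows "w i j * resistance w i j =
    (\<Sum>f | parent_map i f \<and> f j = i. \<Prod>v\<in>UNIV - {i}. w v (f v)) /
    (\<Sum>f | parent_map i f. \<Prod>v\<in>UNIV - {i}. w v (f v))"
  by (simp add: resistance_def matrix_tree matrix_tree_edge[OF assms(1), symmetric] assms(2))

text \<open>The Laplacian never reads \<open>w a a\<close>, so weight functions need to be compared
  only off the diagonal.\<close>

lemma resistance_cong:
  assumes "\<And>a b. a \<noteq> b \<Longrightarrow> w a b = w' a b"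
  shows "resistance w i j = resistance w' i j"
proof -
  have "laplacian w = laplacian w'"
    using assms by (auto simp: laplacian_def vec_eq_iff intro!: sum.cong)
  then show ?thesis by (simp add: resistance_def)
qed

text \<open>For trees rooted at \<open>i\<close>, only \<open>j\<close> can own the edge
  \<open>{i, j}\<close>. Hence the product over a tree contains \<open>t\<close> exactly once if
  \<open>f j = i\<close> and not at all otherwise.\<close>

lemma set_weight_resistance:
  fixes w :: "'k::finite \<Rightarrow> 'k \<Rightarrow> real"
  assumes ij: "i \<noteq> j"
  shows "t * resistance (set_weight i j t w) i j =
    t * (\<Sum>f | parent_map i f \<and> f j = i. \<Prod>v\<in>UNIV - {i, j}. w v (f v)) /
    (t * (\<Sum>f | parent_map i f \<and> f j = i. \<Prod>v\<in>UNIV - {i, j}. w v (f v)) +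
     (\<Sum>f | parent_map i f \<and> f j \<noteq> i. \<Prod>v\<in>UNIV - {i}. w v (f v)))"
proof -
  let ?w = "set_weight i j t w"
  have w: "?w i j = t" "?w j i = t" by (auto simp: set_weight_def)
  have other: "?w v (f v) = w v (f v)" if "parent_map i f" "v \<noteq> i" "v \<noteq> j \<or> f j \<noteq> i" for f v
    using that by (auto simp: set_weight_def doubleton_eq_iff)
  have "(\<Prod>v\<in>UNIV - {i}. ?w v (f v)) = t * (\<Prod>v\<in>UNIV - {i, j}. w v (f v))"
    if f: "parent_map i f" "f j = i" for f
  proof -
    have "(\<Prod>v\<in>UNIV - {i}. ?w v (f v)) = ?w j (f j) * (\<Prod>v\<in>UNIV - {i} - {j}. ?w v (f v))"
      using ij by (intro prod.remove) auto
    also have "(\<Prod>v\<in>UNIV - {i} - {j}. ?w v (f v)) = (\<Prod>v\<in>UNIV - {i, j}. w v (f v))"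
      using other[OF f(1)] by (intro prod.cong) auto
    finally show ?thesis by (simp add: f(2) w)
  qed
  then have N: "(\<Sum>f | parent_map i f \<and> f j = i. \<Prod>v\<in>UNIV - {i}. ?w v (f v)) =
      t * (\<Sum>f | parent_map i f \<and> f j = i. \<Prod>v\<in>UNIV - {i, j}. w v (f v))"
    by (simp add: sum_distrib_left)
  have "(\<Sum>f | parent_map i f. \<Prod>v\<in>UNIV - {i}. ?w v (f v)) =
      (\<Sum>f\<in>{f. parent_map i f \<and> f j = i} \<union> {f. parent_map i f \<and> f j \<noteq> i}. \<Prod>v\<in>UNIV - {i}. ?w v (f v))"
    by (rule sum.cong) auto
  also have "\<dots> = (\<Sum>f | parent_map i f \<and> f j = i. \<Prod>v\<in>UNIV - {i}. ?w v (f v)) +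
      (\<Sum>f | parent_map i f \<and> f j \<noteq> i. \<Prod>v\<in>UNIV - {i}. ?w v (f v))"
    by (rule sum.union_disjoint) auto
  also have "(\<Sum>f | parent_map i f \<and> f j \<noteq> i. \<Prod>v\<in>UNIV - {i}. ?w v (f v)) =
      (\<Sum>f | parent_map i f \<and> f j \<noteq> i. \<Prod>v\<in>UNIV - {i}. w v (f v))"
    using other by (intro sum.cong prod.cong) auto
  finally show ?thesis
    using weight_mult_resistance[OF ij, of ?w] by (simp add: w N)
qed

lemma parent_map_star: "parent_map i (\<lambda>_. i)"
  unfolding parent_map_def by (auto intro!: exI[of _ "\<lambda>v. if v = i then 0 else 1"])

text \<open>Attaches \<open>k\<close> to \<open>i\<close> and everything else to \<open>k\<close>: a
  tree that avoids \<open>{i, j}\<close> whenever \<open>j\<close> is a third vertex.\<close>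

lemma parent_map_second_star:
  assumes "k \<noteq> i"
  shows "parent_map i (\<lambda>v. if v = i \<or> v = k then i else k)"
  unfolding parent_map_def using assms
  by (auto intro!: exI[of _ "\<lambda>v. if v = i then 0 else if v = k then 1 else 2"])

text \<open>The increment from \<open>s\<close> to \<open>t\<close> has numerator
  \<open>(t - s) * A * B\<close>. The star at \<open>i\<close> gives \<open>A > 0\<close>, and a
  third vertex gives a tree without \<open>{i, j}\<close>, so \<open>B > 0\<close>. With only two
  vertices the edge is certain and \<open>F\<close> is constantly 1 on the positive reals.\<close>

lemma set_weight_resistance_mono:
  fixes w :: "'k::finite \<Rightarrow> 'k \<Rightarrow> real"
  assumes ij: "i \<noteq> j" and w: "\<And>a b. a \<noteq> b \<Longrightarrow> w a b > 0"
  defines "F \<equiv> \<lambda>t. t * resistance (set_weight i j t w) i j"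
  shows "mono_on {0<..} F" and "CARD('k) \<ge> 3 \<Longrightarrow> strict_mono_on {0<..} F"
proof -
  define A where "A = (\<Sum>f | parent_map i f \<and> f j = i. \<Prod>v\<in>UNIV - {i, j}. w v (f v))"
  define B where "B = (\<Sum>f | parent_map i f \<and> f j \<noteq> i. \<Prod>v\<in>UNIV - {i}. w v (f v))"
  have F: "F t = t * A / (t * A + B)" for t
    unfolding F_def A_def B_def by (rule set_weight_resistance[OF ij])
  have pos: "0 < w v (f v)" if "parent_map i f" "v \<noteq> i" for f v
    using w[of v "f v"] parent_map_fixed_iff[OF that(1), of v] that(2) by auto
  have A: "A > 0"
    unfolding A_def using parent_map_star[of i] pos
    by (intro sum_pos prod_pos) auto
  have B: "B \<ge> 0"
    unfolding B_def using pos by (intro sum_nonneg prod_nonneg) (auto intro: less_imp_le)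
  have diff: "F t - F s = (t - s) * A * B / ((t * A + B) * (s * A + B))" if "0 < s" "0 < t" for s t
  proof -
    have "0 < s * A + B" "0 < t * A + B" using that A B by (auto intro: add_pos_nonneg)
    then have "s * A + B \<noteq> 0" "t * A + B \<noteq> 0" by auto
    then show ?thesis unfolding F by (simp add: diff_frac_eq) (simp add: algebra_simps)
  qed
  have den: "0 < (t * A + B) * (s * A + B)" if "0 < s" "0 < t" for s t
    using that A B by (auto intro!: mult_pos_pos add_pos_nonneg)
  show "mono_on {0<..} F"
  proof (rule mono_onI)
    fix s t :: real assume st: "s \<in> {0<..}" "t \<in> {0<..}" "s \<le> t"
    then have "0 \<le> F t - F s"
      using diff[of s t] den[of s t] A B by (auto intro!: divide_nonneg_pos)
    then show "F s \<le> F t" by simp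
  qed
  show "strict_mono_on {0<..} F" if card: "CARD('k) \<ge> 3"
  proof (rule strict_mono_onI)
    fix s t :: real assume st: "s \<in> {0<..}" "t \<in> {0<..}" "s < t"
    have "card {i, j} < CARD('k)" using card ij by simp
    then have "{i, j} \<noteq> UNIV" by force
    then obtain k where k: "k \<noteq> i" "k \<noteq> j" by auto
    have "(\<lambda>v. if v = i \<or> v = k then i else k) \<in> {f. parent_map i f \<and> f j \<noteq> i}"
      using parent_map_second_star[OF k(1)] ij k by auto
    then have "B > 0"
      unfolding B_def by (intro sum_pos prod_pos) (auto intro: pos)
    then have "0 < F t - F s"
      using st diff[of s t] den[of s t] A by auto
    then show "F s < F t" by simp
  qed
qed

text \<open>For the second claim, the weights other than that of \<open>{i, j}\<close> are held at
  their given values. A single \<open>F\<close> then serves all data sets and hyperparameters that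
  share those weights, which makes the probability a function of one variable.\<close>

theorem proposition2:
  fixes x :: "real^'k^'n" and D :: "real^'k^'k" and \<delta> :: real and i j :: 'k
  assumes "standardized x" and "\<delta> > 0" and "pos_def D" and "i \<noteq> j"
  shows "edge_probability \<delta> D x i j = weight \<delta> D x i j * resistance (weight \<delta> D x) i j \<and>
         (\<exists>F :: real \<Rightarrow> real.
           (\<forall>t>0. F t = t * resistance (set_weight i j t (weight \<delta> D x)) i j) \<and>
           (\<forall>(x' :: real^'k^'n) D' \<delta>'.
              standardized x' \<and> \<delta>' > 0 \<and> pos_def D' \<and>
              (\<forall>a b. a \<noteq> b \<and> {a, b} \<noteq> {i, j} \<longrightarrow> weight \<delta>' D' x' a b = weight \<delta> D x a b) \<longrightarrow>
              weight \<delta>' D' x' i j > 0 \<and>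
              edge_probability \<delta>' D' x' i j = F (weight \<delta>' D' x' i j)) \<and>
           mono_on {0<..} F \<and> (CARD('k) \<ge> 3 \<longrightarrow> strict_mono_on {0<..} F))"
proof (intro conjI exI allI impI)
  note ij = assms(4)
  have prob: "edge_probability \<delta> D x i j = weight \<delta> D x i j * resistance (weight \<delta> D x) i j"
    if "\<delta> > 0" "pos_def D" for \<delta> and D :: "real^'k^'k" and x :: "real^'k^'n"
    using edge_probability_parent_maps[OF that ij] weight_mult_resistance[of i j "weight \<delta> D x", OF ij weight_commute[OF ij]] by simp
  let ?F = "\<lambda>t. t * resistance (set_weight i j t (weight \<delta> D x)) i j"
  show "edge_probability \<delta> D x i j = weight \<delta> D x i j * resistance (weight \<delta> D x) i j"
    using prob assms by blast
  show "?F t = t * resistance (set_weight i j t (weight \<delta> D x)) i j" for t ..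
  fix x' :: "real^'k^'n" and D' \<delta>'
  assume *: "standardized x' \<and> \<delta>' > 0 \<and> pos_def D' \<and>
    (\<forall>a b. a \<noteq> b \<and> {a, b} \<noteq> {i, j} \<longrightarrow> weight \<delta>' D' x' a b = weight \<delta> D x a b)"
  then show "weight \<delta>' D' x' i j > 0" using weight_pos ij by blast
  \<comment> \<open>Off the diagonal, the new weights are the old ones with the value at
    \<open>{i, j}\<close> overwritten, so both yield the same resistance.\<close>
  have "weight \<delta>' D' x' a b = set_weight i j (weight \<delta>' D' x' i j) (weight \<delta> D x) a b" if "a \<noteq> b" for a b
    using * that weight_commute[OF ij, of \<delta>' D' x'] by (auto simp: set_weight_def doubleton_eq_iff)
  then show "edge_probability \<delta>' D' x' i j = ?F (weight \<delta>' D' x' i j)"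
    using prob[of \<delta>' D' x'] * resistance_cong[of "weight \<delta>' D' x'"] by metis
next
  show "mono_on {0<..} (\<lambda>t. t * resistance (set_weight i j t (weight \<delta> D x)) i j)"
    using assms by (intro set_weight_resistance_mono weight_pos) auto
  show "strict_mono_on {0<..} (\<lambda>t. t * resistance (set_weight i j t (weight \<delta> D x)) i j)" if "CARD('k) \<ge> 3"
    using assms that by (intro set_weight_resistance_mono weight_pos) auto
qed

end
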